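(* Assume (A0), (A1'), (A2') and (A3') (stated in the context) hold. Then, for any positive sequence $\alpha_n$ with $\frac{1}{\sqrt n}\ll\alpha_n\ll1$, the $\alpha_n$-posterior mean $\hat\theta^{\mathrm B}=\int_{\mathbb R^p}\theta\,\pi_{n,\alpha_n}(\theta|X^n)\,d\theta$ is asymptotically equivalent to $\hat\theta$; that is, $$\sqrt n(\hat\theta^{\mathrm B}-\theta^* )\overset{d}{\to}N(0,\tilde V_{\theta}),$$ where $\tilde V_{\theta}$ is the asymptotic variance of the MLE (the covariance of the limiting normal law of $\sqrt n(\hat\theta-\theta^* )$). Furthermore, this remains valid for the $\hat\alpha_n$-posterior mean $\int_{\mathbb R^p}\theta\,\pi_{n,\hat\alpha_n}(\theta|X^n)\,d\theta$ for any positive data-dependent sequence $\hat\alpha_n$ for which there is a positive sequence $\alpha_n$ with $\frac1{\sqrt n}\ll\alpha_n\ll1$ and $\hat\alpha_n/\alpha_n\to1$ in $f_{0,n}$-probability.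
   Context: Setting. For each $n$, $X^n=(X_1,\dots,X_n)\in\mathcal X^n$ ($\mathcal X\subset\mathbb R^d$) is a random sample with true density $f_{0,n}$; $\mathbb P_{f_{0,n}}$ is the corresponding probability. $\{f_n(\cdot|\theta):\theta\in\Theta\subset\mathbb R^p\}$ is a parametric family of densities, possibly misspecified. $\hat\theta=\arg\max_\theta f_n(X^n|\theta)$ is the MLE and $\pi$ is a prior density. For $\alpha>0$ the $\alpha$-posterior has density $\pi_{n,\alpha}(\theta|X^n)=f_n(X^n|\theta)^\alpha\pi(\theta)/\int_{\mathbb R^p}f_n(X^n|\theta)^\alpha\pi(\theta)\,d\theta$; the $\hat\alpha_n$-posterior is obtained by plugging in a data-dependent $\hat\alpha_n$. All these posteriors are assumed proper. Integrands in $\theta$ are understood as zero outside $\Theta$. $a_n\ll b_n$ means $a_n/b_n\to0$. $B_v(r)$ is the open Euclidean ball. For a tensor $S\in\mathbb R^{p\times p\times p}$, $\langle S,h^{\otimes3}\rangle=\sum_{i,j,k}S_{ijk}h_ih_jh_k$. Assumptions; here $\alpha_n$ denotes an arbitrary positive sequence with $\frac1n\ll\alpha_n\ll1$. (A0) The MLE $\hat\theta$ is unique and there exists $\theta^*\in\Theta$, with $\Theta$ an open subset of $\mathbb R^p$, such that $\hat\theta\to\theta^*$ in $f_{0,n}$-probability and $\sqrt n(\hat\theta-\theta^* )$ is asymptotically normal. (A1') The prior $\pi$ is positive and twice continuously differentiable in an open ball around $\theta^*$, and the prior mean is finite. (A2') For $n$ sufficiently large there exist a (data-dependent) matrix $H_n\in\mathbb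 R^{p\times p}$ that is symmetric and positive definite with probability tending to one, a tensor $S_n\in\mathbb R^{p\times p\times p}$, and a constant $M<\infty$ such that for all $\epsilon>0$ and some $\delta>0$, $$\mathbb P_{f_{0,n}}\Big(\sup_{h\in\mathcal H_n}\Big\{|\tilde R_n(h)|-\frac{M}{\alpha_nn}\|h\|_2^4\Big\}>0\Big)<\epsilon,$$ where $\mathcal H_n=\{h\in\mathbb R^p:\|h\|_2/\sqrt{\alpha_nn}\le\delta\}$ and $$\tilde R_n(h)=\alpha_n\Big[\log f_n\Big(X^n\Big|\hat\theta+\tfrac{h}{\sqrt{\alpha_nn}}\Big)-\log f_n(X^n|\hat\theta)\Big]+\tfrac12h^\top H_nh-\tfrac{1}{6\sqrt{\alpha_nn}}\langle S_n,h^{\otimes3}\rangle.$$ (A3') For all $\epsilon>0$ and $\delta'>0$ there exists $c=c(\epsilon,\delta')>0$ such that for $n$ sufficiently large $$\mathbb P_{f_{0,n}}\Big(\sup_{\theta\in B_{\hat\theta}(\delta')^{\mathsf c}}\Big\{\tfrac1n\log f_n(X^n|\theta)-\tfrac1n\log f_n(X^n|\hat\theta)\Big\}>-c\Big)<\epsilon.$$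
   Formalization: In (A2') the matrices H_n are also required to have eigenvalues bounded and bounded away from zero in probability (H_n and its inverse are O_P(1)); with mere positive definiteness the claim is false, e.g. H_n = n^{-10} with a quartic log-likelihood. *)

theory Defs
  imports "HOL-Probability.Probability"
begin

section \<open>Sampling model\<close>

text \<open>A sample of size \<open>n\<close> is a function on \<open>{..<n}\<close>. Densities are taken with respect to the
  \<open>n\<close>-fold product of a sigma-finite measure \<open>\<nu>\<close> on the observation space (for instance Lebesgue
  measure); the joint density \<open>f0 n\<close> need not factorise.\<close>

type_synonym 'd sample = "nat \<Rightarrow> real ^ 'd"

definition sample_measure :: "(real ^ 'd) measure \<Rightarrow> nat \<Rightarrow> 'd sample measure" where
  "sample_measure \<nu> n = Pi\<^sub>M {..<n} (\<lambda>_. \<nu>)"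

definition is_density :: "'a measure \<Rightarrow> ('a \<Rightarrow> real) \<Rightarrow> bool" where
  "is_density M g \<longleftrightarrow> g \<in> borel_measurable M \<and> (\<forall>x\<in>space M. 0 \<le> g x) \<and>
     (\<integral>\<^sup>+ x. ennreal (g x) \<partial>M) = 1"

definition true_law :: "(real ^ 'd) measure \<Rightarrow> (nat \<Rightarrow> 'd sample \<Rightarrow> real) \<Rightarrow> nat \<Rightarrow> 'd sample measure" where
  "true_law \<nu> f0 n = density (sample_measure \<nu> n) (\<lambda>x. ennreal (f0 n x))"

text \<open>\<open>f n x \<theta>\<close> stands for $f_n(x|\theta)$; only its values for \<open>\<theta> \<in> \<Theta>\<close> matter.\<close>

definition likelihood ::
  "(nat \<Rightarrow> 'd sample \<Rightarrow> real ^ 'p \<Rightarrow> real) \<Rightarrow> (real ^ 'p) set \<Rightarrow> nat \<Rightarrow> 'd sample \<Rightarrow> real ^ 'p \<Rightarrow> real" where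
  "likelihood f \<Theta> n x \<theta> = (if \<theta> \<in> \<Theta> then f n x \<theta> else 0)"

text \<open>Extended-real logarithm: \<open>ln 0 = 0\<close> in HOL, whereas a vanishing likelihood must have
  log-likelihood \<open>-\<infinity>\<close>.\<close>

definition log_likelihood ::
  "(nat \<Rightarrow> 'd sample \<Rightarrow> real ^ 'p \<Rightarrow> real) \<Rightarrow> (real ^ 'p) set \<Rightarrow> nat \<Rightarrow> 'd sample \<Rightarrow> real ^ 'p \<Rightarrow> ereal" where
  "log_likelihood f \<Theta> n x \<theta> =
     (if 0 < likelihood f \<Theta> n x \<theta> then ereal (ln (likelihood f \<Theta> n x \<theta>)) else -\<infinity>)"

text \<open>The index \<open>n = 0\<close> is excluded throughout: on a one-point sample space all densities coincide
  and no MLE could be unique.\<close>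

definition statistical_model ::
  "(real ^ 'd) set \<Rightarrow> (real ^ 'd) measure \<Rightarrow> (nat \<Rightarrow> 'd sample \<Rightarrow> real) \<Rightarrow>
   (nat \<Rightarrow> 'd sample \<Rightarrow> real ^ 'p \<Rightarrow> real) \<Rightarrow> (real ^ 'p) set \<Rightarrow> bool" where
  "statistical_model \<X> \<nu> f0 f \<Theta> \<longleftrightarrow>
     sigma_finite_measure \<nu> \<and> sets \<nu> = sets (restrict_space borel \<X>) \<and>
     (\<forall>n\<ge>1. is_density (sample_measure \<nu> n) (f0 n)) \<and>
     (\<forall>n\<ge>1. \<forall>\<theta>\<in>\<Theta>. is_density (sample_measure \<nu> n) (\<lambda>x. f n x \<theta>)) \<and>
     (\<forall>n\<ge>1. (\<lambda>(x, \<theta>). likelihood f \<Theta> n x \<theta>) \<in> borel_measurable (sample_measure \<nu> n \<Otimes>\<^sub>M borel))"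

definition is_prior :: "(real ^ 'p) set \<Rightarrow> (real ^ 'p \<Rightarrow> real) \<Rightarrow> bool" where
  "is_prior \<Theta> \<pi> \<longleftrightarrow> is_density lborel (\<lambda>\<theta>. indicator \<Theta> \<theta> * \<pi> \<theta>)"

definition is_MLE ::
  "(nat \<Rightarrow> 'd sample \<Rightarrow> real ^ 'p \<Rightarrow> real) \<Rightarrow> (real ^ 'p) set \<Rightarrow> nat \<Rightarrow> 'd sample \<Rightarrow> real ^ 'p \<Rightarrow> bool" where
  "is_MLE f \<Theta> n x \<theta> \<longleftrightarrow> is_arg_max (f n x) (\<lambda>\<theta>. \<theta> \<in> \<Theta>) \<theta>"


section \<open>Posteriors\<close>

definition posterior_density ::
  "(nat \<Rightarrow> 'd sample \<Rightarrow> real ^ 'p \<Rightarrow> real) \<Rightarrow> (real ^ 'p) set \<Rightarrow> (real ^ 'p \<Rightarrow> real) \<Rightarrow>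
   nat \<Rightarrow> real \<Rightarrow> 'd sample \<Rightarrow> real ^ 'p \<Rightarrow> real" where
  "posterior_density f \<Theta> \<pi> n \<alpha> x \<theta> =
     likelihood f \<Theta> n x \<theta> powr \<alpha> * \<pi> \<theta> / (\<integral>t. likelihood f \<Theta> n x t powr \<alpha> * \<pi> t \<partial>lborel)"

definition posterior_proper ::
  "(nat \<Rightarrow> 'd sample \<Rightarrow> real ^ 'p \<Rightarrow> real) \<Rightarrow> (real ^ 'p) set \<Rightarrow> (real ^ 'p \<Rightarrow> real) \<Rightarrow>
   nat \<Rightarrow> real \<Rightarrow> 'd sample \<Rightarrow> bool" where
  "posterior_proper f \<Theta> \<pi> n \<alpha> x \<longleftrightarrow>
     integrable lborel (\<lambda>\<theta>. likelihood f \<Theta> n x \<theta> powr \<alpha> * \<pi> \<theta>) \<and>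
     0 < (\<integral>\<theta>. likelihood f \<Theta> n x \<theta> powr \<alpha> * \<pi> \<theta> \<partial>lborel)"

definition posterior_mean ::
  "(nat \<Rightarrow> 'd sample \<Rightarrow> real ^ 'p \<Rightarrow> real) \<Rightarrow> (real ^ 'p) set \<Rightarrow> (real ^ 'p \<Rightarrow> real) \<Rightarrow>
   nat \<Rightarrow> real \<Rightarrow> 'd sample \<Rightarrow> real ^ 'p" where
  "posterior_mean f \<Theta> \<pi> n \<alpha> x = (\<integral>\<theta>. posterior_density f \<Theta> \<pi> n \<alpha> x \<theta> *\<^sub>R \<theta> \<partial>lborel)"


section \<open>Modes of convergence\<close>

text \<open>Probabilities of events that need not be measurable (they involve suprema over uncountable
  sets) are outer probabilities; on measurable events this is the usual probability.\<close>

definition outer_prob :: "'a measure \<Rightarrow> ('a \<Rightarrow> bool) \<Rightarrow> ennreal" where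
  "outer_prob M E = outer_measure_of M {x \<in> space M. E x}"

definition tends_in_prob ::
  "(nat \<Rightarrow> 'a measure) \<Rightarrow> (nat \<Rightarrow> 'a \<Rightarrow> 'b::metric_space) \<Rightarrow> 'b \<Rightarrow> bool" where
  "tends_in_prob P Y c \<longleftrightarrow> (\<forall>\<epsilon>>0. (\<lambda>n. outer_prob (P n) (\<lambda>x. \<epsilon> < dist (Y n x) c)) \<longlonglongrightarrow> 0)"

definition tends_in_distr ::
  "(nat \<Rightarrow> 'a measure) \<Rightarrow> (nat \<Rightarrow> 'a \<Rightarrow> real ^ 'p) \<Rightarrow> (real ^ 'p) measure \<Rightarrow> bool" where
  "tends_in_distr P Y \<mu> \<longleftrightarrow>
     (\<forall>\<^sub>F n in sequentially. Y n \<in> borel_measurable (P n)) \<and>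
     (\<forall>g :: real ^ 'p \<Rightarrow> real. continuous_on UNIV g \<longrightarrow> bounded (range g) \<longrightarrow>
        (\<lambda>n. \<integral>x. g (Y n x) \<partial>P n) \<longlonglongrightarrow> (\<integral>y. g y \<partial>\<mu>))"

definition pos_semidef :: "real ^ 'p ^ 'p \<Rightarrow> bool" where
  "pos_semidef V \<longleftrightarrow> transpose V = V \<and> (\<forall>h. 0 \<le> h \<bullet> (V *v h))"

definition pos_def :: "real ^ 'p ^ 'p \<Rightarrow> bool" where
  "pos_def V \<longleftrightarrow> transpose V = V \<and> (\<forall>h. h \<noteq> 0 \<longrightarrow> 0 < h \<bullet> (V *v h))"

definition std_normal_vec :: "(real ^ 'p) measure" where
  "std_normal_vec = density lborel (\<lambda>z. ennreal (\<Prod>i\<in>UNIV. std_normal_density (z $ i)))"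

text \<open>$N(0,V)$ for positive semidefinite, possibly singular \<open>V\<close>, as the law of \<open>A *v Z\<close> with
  \<open>Z\<close> standard normal and $A A^\top = V$. The law does not depend on the choice of \<open>A\<close>.\<close>

definition centred_normal :: "real ^ 'p ^ 'p \<Rightarrow> (real ^ 'p) measure" where
  "centred_normal V = distr std_normal_vec borel (\<lambda>z. (SOME A :: real ^ 'p ^ 'p. A ** transpose A = V) *v z)"

text \<open>A positive sequence \<open>\<alpha>\<close> with $r_n \ll \alpha_n \ll 1$.\<close>

definition vanishing_slower :: "(nat \<Rightarrow> real) \<Rightarrow> (nat \<Rightarrow> real) \<Rightarrow> bool" where
  "vanishing_slower r \<alpha> \<longleftrightarrow>
     (\<forall>n\<ge>1. 0 < \<alpha> n) \<and> (\<lambda>n. r n / \<alpha> n) \<longlonglongrightarrow> 0 \<and> \<alpha> \<longlonglongrightarrow> 0"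


section \<open>Assumptions\<close>

definition assm_A0 ::
  "(nat \<Rightarrow> 'd sample measure) \<Rightarrow> (nat \<Rightarrow> 'd sample \<Rightarrow> real ^ 'p \<Rightarrow> real) \<Rightarrow> (real ^ 'p) set \<Rightarrow>
   (nat \<Rightarrow> 'd sample \<Rightarrow> real ^ 'p) \<Rightarrow> real ^ 'p \<Rightarrow> real ^ 'p ^ 'p \<Rightarrow> bool" where
  "assm_A0 P f \<Theta> \<theta>hat \<theta>star V \<longleftrightarrow>
     open \<Theta> \<and> \<theta>star \<in> \<Theta> \<and>
     (\<forall>n\<ge>1. \<theta>hat n \<in> borel_measurable (P n)) \<and>
     (\<forall>n\<ge>1. AE x in P n. \<forall>\<theta>. is_MLE f \<Theta> n x \<theta> \<longleftrightarrow> \<theta> = \<theta>hat n x) \<and>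
     tends_in_prob P \<theta>hat \<theta>star \<and>
     pos_semidef V \<and>
     tends_in_distr P (\<lambda>n x. sqrt (real n) *\<^sub>R (\<theta>hat n x - \<theta>star)) (centred_normal V)"

definition twice_cont_diff_on :: "(real ^ 'p) set \<Rightarrow> (real ^ 'p \<Rightarrow> real) \<Rightarrow> bool" where
  "twice_cont_diff_on U g \<longleftrightarrow>
     (\<exists>(grad :: real ^ 'p \<Rightarrow> real ^ 'p) (hess :: real ^ 'p \<Rightarrow> real ^ 'p ^ 'p).
        (\<forall>\<theta>\<in>U. (g has_derivative (\<lambda>h. grad \<theta> \<bullet> h)) (at \<theta>)) \<and>
        (\<forall>\<theta>\<in>U. (grad has_derivative (\<lambda>h. hess \<theta> *v h)) (at \<theta>)) \<and>
        continuous_on U hess)"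

definition assm_A1' :: "(real ^ 'p) set \<Rightarrow> (real ^ 'p \<Rightarrow> real) \<Rightarrow> real ^ 'p \<Rightarrow> bool" where
  "assm_A1' \<Theta> \<pi> \<theta>star \<longleftrightarrow>
     (\<exists>r>0. (\<forall>\<theta>\<in>ball \<theta>star r. 0 < \<pi> \<theta>) \<and> twice_cont_diff_on (ball \<theta>star r) \<pi>) \<and>
     integrable lborel (\<lambda>\<theta>. (indicator \<Theta> \<theta> * \<pi> \<theta>) *\<^sub>R \<theta>)"

definition cubic_form :: "real ^ 'p ^ 'p ^ 'p \<Rightarrow> real ^ 'p \<Rightarrow> real" where
  "cubic_form S h = (\<Sum>i\<in>UNIV. \<Sum>j\<in>UNIV. \<Sum>k\<in>UNIV. S $ i $ j $ k * h $ i * h $ j * h $ k)"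

definition R_tilde ::
  "(nat \<Rightarrow> 'd sample \<Rightarrow> real ^ 'p \<Rightarrow> real) \<Rightarrow> (real ^ 'p) set \<Rightarrow> (nat \<Rightarrow> 'd sample \<Rightarrow> real ^ 'p) \<Rightarrow>
   (nat \<Rightarrow> 'd sample \<Rightarrow> real ^ 'p ^ 'p) \<Rightarrow> (nat \<Rightarrow> 'd sample \<Rightarrow> real ^ 'p ^ 'p ^ 'p) \<Rightarrow>
   (nat \<Rightarrow> real) \<Rightarrow> nat \<Rightarrow> 'd sample \<Rightarrow> real ^ 'p \<Rightarrow> ereal" where
  "R_tilde f \<Theta> \<theta>hat H S \<alpha> n x h =
     ereal (\<alpha> n) * (log_likelihood f \<Theta> n x (\<theta>hat n x + h /\<^sub>R sqrt (\<alpha> n * real n))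
                    - log_likelihood f \<Theta> n x (\<theta>hat n x))
     + ereal (1 / 2 * (h \<bullet> (H n x *v h)))
     - ereal (1 / (6 * sqrt (\<alpha> n * real n)) * cubic_form (S n x) h)"

text \<open>The eigenvalues of \<open>H n\<close> stay in a compact subset of $(0,\infty)$ with probability arbitrarily
  close to one, that is, $H_n$ and $H_n^{-1}$ are $O_P(1)$. It is imposed in addition to
  \<open>pos_def (H n x)\<close> for each \<open>n\<close>, which alone is not enough for the conclusion: it allows
  $H_n \to 0$, where the \<open>\<alpha>\<close>-posterior may contract only at the quartic rate
  $(n\alpha_n)^{-1/4}$, and it allows exponentially large $H_n$, where the posterior mass near
  the MLE may be negligible. In both cases the posterior mean can fail to be asymptotically
  equivalent to the MLE.\<close>

definition spectrum_tight ::
  "(nat \<Rightarrow> 'a measure) \<Rightarrow> (nat \<Rightarrow> 'a \<Rightarrow> real ^ 'p ^ 'p) \<Rightarrow> bool" where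
  "spectrum_tight P H \<longleftrightarrow>
     (\<forall>\<epsilon>>0. \<exists>l>0. \<exists>u. \<forall>\<^sub>F n in sequentially.
        outer_prob (P n) (\<lambda>x. \<not> (\<forall>h. l * (norm h)\<^sup>2 \<le> h \<bullet> (H n x *v h) \<and>
                                      h \<bullet> (H n x *v h) \<le> u * (norm h)\<^sup>2)) < ennreal \<epsilon>)"

definition assm_A2' ::
  "(nat \<Rightarrow> 'd sample measure) \<Rightarrow> (nat \<Rightarrow> 'd sample \<Rightarrow> real ^ 'p \<Rightarrow> real) \<Rightarrow> (real ^ 'p) set \<Rightarrow>
   (nat \<Rightarrow> 'd sample \<Rightarrow> real ^ 'p) \<Rightarrow> (nat \<Rightarrow> real) \<Rightarrow> bool" where
  "assm_A2' P f \<Theta> \<theta>hat \<alpha> \<longleftrightarrow>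
     (\<exists>(H :: nat \<Rightarrow> 'd sample \<Rightarrow> real ^ 'p ^ 'p) (S :: nat \<Rightarrow> 'd sample \<Rightarrow> real ^ 'p ^ 'p ^ 'p) (M :: real).
        (\<lambda>n. outer_prob (P n) (\<lambda>x. \<not> pos_def (H n x))) \<longlonglongrightarrow> 0 \<and>
        spectrum_tight P H \<and>
        (\<forall>\<epsilon>>0. \<exists>\<delta>>0. \<forall>\<^sub>F n in sequentially.
           outer_prob (P n) (\<lambda>x.
             (SUP h \<in> {h. norm h / sqrt (\<alpha> n * real n) \<le> \<delta>}.
                \<bar>R_tilde f \<Theta> \<theta>hat H S \<alpha> n x h\<bar> - ereal (M / (\<alpha> n * real n) * norm h ^ 4)) > 0)
           < ennreal \<epsilon>))"

definition assm_A3' ::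
  "(nat \<Rightarrow> 'd sample measure) \<Rightarrow> (nat \<Rightarrow> 'd sample \<Rightarrow> real ^ 'p \<Rightarrow> real) \<Rightarrow> (real ^ 'p) set \<Rightarrow>
   (nat \<Rightarrow> 'd sample \<Rightarrow> real ^ 'p) \<Rightarrow> bool" where
  "assm_A3' P f \<Theta> \<theta>hat \<longleftrightarrow>
     (\<forall>\<epsilon>>0. \<forall>\<delta>'>0. \<exists>c::real. c > 0 \<and> (\<forall>\<^sub>F n in sequentially.
        outer_prob (P n) (\<lambda>x.
          (SUP \<theta> \<in> - ball (\<theta>hat n x) \<delta>'.
             ereal (1 / real n) * log_likelihood f \<Theta> n x \<theta>
             - ereal (1 / real n) * log_likelihood f \<Theta> n x (\<theta>hat n x)) > - ereal c)
        < ennreal \<epsilon>))"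

end

theory Submission
  imports Defs
begin

text \<open>The posterior with learning rate \<open>\<alpha>\<close> has the effective sample size \<open>N = \<alpha> * n\<close>, so in the
  coordinate \<open>h = sqrt N *\<^sub>R (\<theta> - \<theta>hat)\<close> it is close to the centred Gaussian density
  $\exp(-h^\top H_n h/2)$. A Gaussian approximation in itself only places the posterior mean within
  $o(N^{-1/2})$ of the MLE, and since $\alpha_n \to 0$ this is not small compared with $n^{-1/2}$. The
  gain comes from symmetry: the leading Gaussian term is even in \<open>h\<close> and has mean
  zero, and the cubic term of the log-likelihood and the gradient of the prior are both relative
  corrections of size $N^{-1/2}$ in \<open>h\<close>. Hence the mean of \<open>h\<close> is $O(N^{-1/2})$, and the posterior mean
  differs from the MLE by $O(1/N) = O(1/(\alpha_n n))$. Multiplied by $\sqrt n$ this is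
  $O(1/(\alpha_n \sqrt n))$, which vanishes because $\alpha_n \gg n^{-1/2}$.

  This bound is deterministic: \<open>laplace_mean_bound\<close> gives it for every weight with a quadratic
  expansion up to a cubic remainder near its centre and an exponentially small tail, with a constant
  that depends only on the constants in these bounds. Uniformity in \<open>N\<close> is what allows a
  data-dependent \<open>\<alpha>hat\<close>: nothing but \<open>\<alpha>hat n x \<ge> \<alpha> n / 2\<close> enters.

  The model assumptions say that these bounds hold outside events of small outer probability.
  The tensors $S_n$ are not assumed to be bounded, but this follows from the maximality of the
  MLE: the log-likelihood ratio is nonpositive on a ball of fixed radius, the quadratic form is bounded
  there, and a cubic form bounded above on a sphere is bounded in absolute value, being odd
  (\<open>cubic_form_bound\<close>, \<open>log_likelihood_cubic_remainder\<close>). So the third-order expansion can be used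
  as a second-order expansion with a uniformly cubic error.

  Finally, a sequence that is close in probability to one converging in distribution has the same
  limit (\<open>tends_in_distr_perturb\<close>). The deterministic learning rate is the case
  of an \<open>\<alpha>hat\<close> that is constant in the data.\<close>

section \<open>Gaussian integrals on Euclidean space\<close>

lemma integrable_lborel_affine:
  fixes F :: "'a::euclidean_space \<Rightarrow> 'b::{banach, second_countable_topology}"
  assumes "integrable lborel F" and c: "c \<noteq> 0"
  shows "integrable lborel (\<lambda>h. F (t + c *\<^sub>R h))"
proof -
  have [measurable]: "F \<in> borel_measurable borel" using assms(1) by auto
  have "integrable (density (distr lborel borel (\<lambda>x. t + c *\<^sub>R x)) (\<lambda>_. ennreal (\<bar>c\<bar> ^ DIM('a)))) F"
    using assms(1) lborel_affine[OF c, of t] by (simp add: ennreal_power)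
  then have "integrable lborel (\<lambda>h. \<bar>c\<bar> ^ DIM('a) *\<^sub>R F (t + c *\<^sub>R h))"
    by (simp add: integrable_density integrable_distr_eq)
  then have "integrable lborel (\<lambda>h. inverse (\<bar>c\<bar> ^ DIM('a)) *\<^sub>R \<bar>c\<bar> ^ DIM('a) *\<^sub>R F (t + c *\<^sub>R h))"
    by (rule integrable_scaleR_right)
  moreover have "inverse (\<bar>c\<bar> ^ DIM('a)) *\<^sub>R \<bar>c\<bar> ^ DIM('a) *\<^sub>R v = v" for v :: 'b
    using c by simp
  ultimately show ?thesis by (simp only:)
qed

lemma integral_lborel_affine:
  fixes F :: "'a::euclidean_space \<Rightarrow> 'b::{banach, second_countable_topology}"
  assumes [measurable]: "F \<in> borel_measurable borel" and c: "c \<noteq> 0"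
  shows "integral\<^sup>L lborel F = \<bar>c\<bar> ^ DIM('a) *\<^sub>R (\<integral>h. F (t + c *\<^sub>R h) \<partial>lborel)"
proof -
  have "integral\<^sup>L lborel F =
      integral\<^sup>L (density (distr lborel borel (\<lambda>x. t + c *\<^sub>R x)) (\<lambda>_. ennreal (\<bar>c\<bar> ^ DIM('a)))) F"
    using lborel_affine[OF c, of t] by (simp add: ennreal_power)
  also have "\<dots> = \<bar>c\<bar> ^ DIM('a) *\<^sub>R (\<integral>h. F (t + c *\<^sub>R h) \<partial>lborel)"
    by (simp add: integral_density integral_distr)
  finally show ?thesis .
qed

text \<open>This is the cancellation that makes the posterior mean more accurate than its Gaussian
  approximation: the leading Gaussian term contributes nothing to the first moment.\<close>

lemma integral_odd_eq_0:
  fixes F :: "'a::euclidean_space \<Rightarrow> 'b::{banach, second_countable_topology}"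
  assumes [measurable]: "F \<in> borel_measurable borel" and odd: "\<And>h. F (- h) = - F h"
  shows "integral\<^sup>L lborel F = 0"
proof -
  have "integral\<^sup>L lborel F = - integral\<^sup>L lborel F"
    using integral_lborel_affine[of F "-1" 0] by (simp add: odd)
  then have "2 *\<^sub>R integral\<^sup>L lborel F = 0"
    by (metis add.right_inverse scaleR_2)
  then show ?thesis by simp
qed

text \<open>The squared norm is a sum over coordinates, so the integrand is a product of functions of one
  coordinate each and the integral factorises into one-dimensional normal integrals.\<close>

lemma integrable_gaussian:
  assumes a: "0 < a"
  shows "integrable lborel (\<lambda>h::'a::euclidean_space. exp (- a * (norm h)\<^sup>2))"
proof (rule integrableI_nonneg)
  have fin: "(\<integral>\<^sup>+ x. ennreal (exp (- a * x\<^sup>2)) \<partial>lborel) < \<infinity>"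
  proof -
    define \<sigma> where "\<sigma> = sqrt (1 / (2 * a))"
    have \<sigma>: "0 < \<sigma>" "\<sigma>\<^sup>2 = 1 / (2 * a)" using a by (auto simp: \<sigma>_def)
    have "integrable lborel (\<lambda>x. sqrt (2 * pi * \<sigma>\<^sup>2) * normal_density 0 \<sigma> x)"
      using \<sigma>(1) by (intro integrable_mult_right integrable_normal_density)
    also have "(\<lambda>x. sqrt (2 * pi * \<sigma>\<^sup>2) * normal_density 0 \<sigma> x) = (\<lambda>x. exp (- a * x\<^sup>2))"
      using a by (auto simp: normal_density_def \<sigma>(2) field_simps)
    finally have "integrable lborel (\<lambda>x. exp (- a * x\<^sup>2))" .
    from integrableD(2)[OF this] show ?thesis by (simp add: top.not_eq_extremum)
  qed
  have "(\<integral>\<^sup>+ h. ennreal (exp (- a * (norm h)\<^sup>2)) \<partial>(lborel::'a measure))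
      = (\<integral>\<^sup>+ h. (\<Prod>b\<in>Basis. ennreal (exp (- a * (h \<bullet> b)\<^sup>2))) \<partial>(lborel::'a measure))"
  proof (rule nn_integral_cong)
    fix h :: 'a
    have "(norm h)\<^sup>2 = (\<Sum>b\<in>Basis. (h \<bullet> b)\<^sup>2)"
      unfolding power2_norm_eq_inner by (subst euclidean_inner) (simp add: power2_eq_square)
    then show "ennreal (exp (- a * (norm h)\<^sup>2)) = (\<Prod>b\<in>Basis. ennreal (exp (- a * (h \<bullet> b)\<^sup>2)))"
      by (simp add: prod_ennreal exp_sum sum_distrib_left flip: sum_negf)
  qed
  also have "\<dots> = (\<Prod>b\<in>(Basis::'a set). \<integral>\<^sup>+ x. ennreal (exp (- a * x\<^sup>2)) \<partial>lborel)"
    by (rule nn_integral_lborel_prod) auto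
  also have "\<dots> < \<infinity>"
    using fin by (simp add: ennreal_prod_eq_top top.not_eq_extremum power_less_top_ennreal)
  finally show "(\<integral>\<^sup>+ h. ennreal (exp (- a * (norm h)\<^sup>2)) \<partial>(lborel::'a measure)) < \<infinity>" .
qed auto

text \<open>Comparing with one term of the exponential series gives
  $(a x^2)^k/k! \le \exp(a x^2)$, which controls $x^{2k}$ and hence $x^k \le 1 + x^{2k}$.\<close>

lemma power_times_gaussian_bounded:
  fixes a :: real
  assumes a: "0 < a"
  obtains B where "0 < B" "\<And>x. 0 \<le> x \<Longrightarrow> x ^ k * exp (- a * x\<^sup>2) \<le> B"
proof -
  define B where "B = 1 + fact k / a ^ k"
  have "x ^ k \<le> B * exp (a * x\<^sup>2)" if "0 \<le> x" for x :: real
  proof -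
    have "(a * x\<^sup>2) ^ k / fact k = (\<Sum>i\<in>{k}. (a * x\<^sup>2) ^ i /\<^sub>R fact i)"
      by (simp add: divide_inverse mult.commute)
    also have "\<dots> \<le> (\<Sum>i. (a * x\<^sup>2) ^ i /\<^sub>R fact i)"
      using a by (intro sum_le_suminf summable_exp_generic) auto
    also have "\<dots> = exp (a * x\<^sup>2)" by (simp add: exp_def)
    finally have "(x\<^sup>2) ^ k \<le> fact k / a ^ k * exp (a * x\<^sup>2)"
      using a by (simp add: field_simps)
    moreover have "x ^ k \<le> 1 + (x\<^sup>2) ^ k"
    proof (cases "x \<le> 1")
      case True
      then have "x ^ k \<le> 1" using that by (simp add: power_le_one)
      then show ?thesis by (smt (verit) zero_le_power zero_le_power2)
    next
      case False
      then have "x ^ k \<le> (x\<^sup>2) ^ k" by (intro power_mono) (auto simp: power2_eq_square)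
      then show ?thesis by simp
    qed
    moreover have "1 \<le> exp (a * x\<^sup>2)" using a by simp
    ultimately show ?thesis unfolding B_def distrib_right by linarith
  qed
  then have "x ^ k * exp (- a * x\<^sup>2) \<le> B" if "0 \<le> x" for x :: real
    using that by (simp add: exp_minus divide_inverse[symmetric] pos_divide_le_eq)
  moreover have "0 < B" using a by (simp add: B_def add_pos_nonneg)
  ultimately show ?thesis using that by blast
qed

text \<open>Half of the Gaussian exponent absorbs the power of the norm; the other half remains integrable.\<close>

lemma integrable_gaussian_moment:
  assumes a: "0 < a"
  shows "integrable lborel (\<lambda>h::'a::euclidean_space. norm h ^ k * exp (- a * (norm h)\<^sup>2))"
proof -
  obtain B where "0 < B" and B: "\<And>x. 0 \<le> x \<Longrightarrow> x ^ k * exp (- (a / 2) * x\<^sup>2) \<le> B"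
    using power_times_gaussian_bounded[of "a / 2"] a by auto
  show ?thesis
  proof (rule Bochner_Integration.integrable_bound)
    show "integrable lborel (\<lambda>h::'a. B * exp (- (a / 2) * (norm h)\<^sup>2))"
      using a by (intro integrable_mult_right integrable_gaussian) auto
    show "AE h in lborel. norm (norm h ^ k * exp (- a * (norm h)\<^sup>2)) \<le> norm (B * exp (- (a / 2) * (norm (h::'a))\<^sup>2))"
    proof (rule AE_I2)
      fix h :: 'a
      have "norm h ^ k * exp (- a * (norm h)\<^sup>2)
          = norm h ^ k * exp (- (a / 2) * (norm h)\<^sup>2) * exp (- (a / 2) * (norm h)\<^sup>2)"
        by (simp flip: exp_add)
      also have "\<dots> \<le> B * exp (- (a / 2) * (norm h)\<^sup>2)"
        by (intro mult_right_mono B) auto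
      finally have "norm h ^ k * exp (- a * (norm h)\<^sup>2) \<le> B * exp (- (a / 2) * (norm h)\<^sup>2)" .
      then show "norm (norm h ^ k * exp (- a * (norm h)\<^sup>2)) \<le> norm (B * exp (- (a / 2) * (norm h)\<^sup>2))"
        using \<open>0 < B\<close> by (simp add: abs_mult)
    qed
  qed auto
qed

text \<open>The mean value inequality for the exponential function, with a common upper bound \<open>z\<close> of both
  exponents. Applied to a perturbed Gaussian, \<open>z\<close> is a slightly wider Gaussian exponent.\<close>

lemma abs_exp_diff_le:
  fixes x y z :: real
  assumes "x \<le> z" "y \<le> z"
  shows "\<bar>exp x - exp y\<bar> \<le> \<bar>x - y\<bar> * exp z"
proof -
  have *: "exp b - exp a \<le> (b - a) * exp z" if "a \<le> b" "b \<le> z" for a b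
  proof -
    have "exp b - exp a = exp b * (1 - exp (a - b))"
      by (simp add: algebra_simps flip: exp_add)
    also have "\<dots> \<le> exp b * (b - a)"
      using exp_ge_add_one_self[of "a - b"] by (intro mult_left_mono; linarith?) auto
    also have "\<dots> \<le> exp z * (b - a)" using that by (intro mult_right_mono) auto
    finally show ?thesis by (simp add: mult.commute)
  qed
  show ?thesis
    using *[of x y] *[of y x] assms by (cases "x \<le> y") auto
qed

section \<open>A first-order Laplace approximation\<close>

text \<open>The integrand is \<open>w x * q x\<close>, where \<open>w\<close> plays the part of the normalised tempered
  likelihood with centre \<open>m\<close> and effective sample size \<open>N\<close>, and \<open>q\<close> that of the prior density. The
  parameters up to \<open>D\<close> are the constants on which the final bound may depend; those from
  \<open>N\<close> on vary with the data. The quadratic form is a homogeneous function \<open>Q\<close> rather than a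
  matrix, which keeps the Laplace argument free of coordinates.\<close>

definition laplace_setting ::
  "real \<Rightarrow> real \<Rightarrow> real \<Rightarrow> real \<Rightarrow> real \<Rightarrow> real \<Rightarrow> real \<Rightarrow> real \<Rightarrow> real \<Rightarrow> real \<Rightarrow>
   'a::euclidean_space \<Rightarrow> ('a \<Rightarrow> real) \<Rightarrow> ('a \<Rightarrow> real) \<Rightarrow> ('a \<Rightarrow> real) \<Rightarrow> bool" where
  "laplace_setting l u C \<delta> c q0 q1 L D N m Q w q \<longleftrightarrow>
     1 \<le> N \<and> Q \<in> borel_measurable borel \<and> w \<in> borel_measurable borel \<and>
     (\<forall>r h. Q (r *\<^sub>R h) = r\<^sup>2 * Q h) \<and> (\<forall>h. l * (norm h)\<^sup>2 \<le> Q h \<and> Q h \<le> u * (norm h)\<^sup>2) \<and>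
     (\<forall>x. norm (x - m) < \<delta> \<longrightarrow>
        (\<exists>r. \<bar>r\<bar> \<le> C * norm (x - m) ^ 3 \<and> w x = exp (N * (r - Q (x - m) / 2)))) \<and>
     (\<forall>x. \<delta> \<le> norm (x - m) \<longrightarrow> 0 \<le> w x \<and> w x \<le> exp (- c * N)) \<and>
     (\<forall>x. 0 \<le> q x) \<and>
     (\<forall>x. norm (x - m) < \<delta> \<longrightarrow> q0 \<le> q x \<and> q x \<le> q1 \<and> \<bar>q x - q m\<bar> \<le> L * norm (x - m)) \<and>
     integrable lborel q \<and> integrable lborel (\<lambda>x. norm (x - m) * q x) \<and>
     (\<integral>x. norm (x - m) * q x \<partial>lborel) \<le> D"

text \<open>In the coordinate \<open>h = s *\<^sub>R (x - m)\<close> the quadratic term loses its factor \<open>N\<close>, whereas the remainder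
  \<open>y\<close> keeps a factor \<open>1 / s\<close>. The second bound on \<open>y\<close> is weaker in \<open>s\<close> but ensures that the remainder
  spoils at most half of the Gaussian decay.\<close>

lemma laplace_near:
  assumes set: "laplace_setting l u C \<delta> c q0 q1 L D N m Q w q"
    and C: "0 \<le> C" and C\<delta>: "C * \<delta> \<le> l / 4"
    and s: "s = sqrt N" and h: "norm h < \<delta> * s"
  shows "\<exists>y. w (m + (1 / s) *\<^sub>R h) = exp (y - Q h / 2) \<and> \<bar>y\<bar> \<le> C * norm h ^ 3 / s \<and> \<bar>y\<bar> \<le> l / 4 * (norm h)\<^sup>2"
proof -
  have N: "1 \<le> N" using set by (simp add: laplace_setting_def)
  then have s1: "1 \<le> s" and sN: "s\<^sup>2 = N" by (auto simp: s)
  let ?x = "m + (1 / s) *\<^sub>R h"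
  have nx: "norm (?x - m) = norm h / s" using s1 by simp
  then have "norm (?x - m) < \<delta>" using h s1 by (simp add: field_simps)
  then obtain r where r: "\<bar>r\<bar> \<le> C * norm (?x - m) ^ 3" "w ?x = exp (N * (r - Q (?x - m) / 2))"
    using set unfolding laplace_setting_def by blast
  have "Q (?x - m) = (1 / s)\<^sup>2 * Q h"
    using set unfolding laplace_setting_def by simp
  then have "N * Q (?x - m) = (s\<^sup>2 * (1 / s)\<^sup>2) * Q h" by (simp only: sN mult.assoc)
  then have "N * Q (?x - m) = Q h" using s1 by (simp add: power_divide)
  then have w: "w ?x = exp (N * r - Q h / 2)" using r(2) by (simp add: algebra_simps)
  have "\<bar>N * r\<bar> = s\<^sup>2 * \<bar>r\<bar>" by (simp add: abs_mult flip: sN)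
  also have "\<dots> \<le> s\<^sup>2 * (C * (norm h / s) ^ 3)" using r(1) unfolding nx by (intro mult_left_mono) auto
  also have "\<dots> = C * norm h ^ 3 / s"
    using s1 by (simp add: field_simps power2_eq_square power3_eq_cube)
  finally have b1: "\<bar>N * r\<bar> \<le> C * norm h ^ 3 / s" .
  also have "\<dots> = C * (norm h / s) * (norm h)\<^sup>2" by (simp add: power2_eq_square power3_eq_cube)
  also have "\<dots> \<le> C * \<delta> * (norm h)\<^sup>2"
    using h s1 C by (intro mult_right_mono mult_left_mono) (auto simp: field_simps)
  also have "\<dots> \<le> l / 4 * (norm h)\<^sup>2" using C\<delta> by (intro mult_right_mono) auto
  finally show ?thesis using w b1 by blast
qed

lemma laplace_weight_bounds:
  assumes set: "laplace_setting l u C \<delta> c q0 q1 L D N m Q w q"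
    and l: "0 < l" and C: "0 \<le> C" and C\<delta>: "C * \<delta> \<le> l / 4" and c: "0 < c"
  shows "0 \<le> w x" "w x \<le> 1"
proof -
  have N: "1 \<le> N" using set by (simp add: laplace_setting_def)
  have "0 \<le> w x \<and> w x \<le> 1"
  proof (cases "norm (x - m) < \<delta>")
    case True
    define h where "h = sqrt N *\<^sub>R (x - m)"
    have x: "x = m + (1 / sqrt N) *\<^sub>R h" using N by (simp add: h_def)
    have "norm h < \<delta> * sqrt N" using True N by (simp add: h_def mult.commute)
    then obtain y where y: "w x = exp (y - Q h / 2)" "\<bar>y\<bar> \<le> l / 4 * (norm h)\<^sup>2"
      using laplace_near[OF set C C\<delta> refl, of h] x by auto
    have "l * (norm h)\<^sup>2 \<le> Q h" using set by (simp add: laplace_setting_def)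
    moreover have "0 \<le> l * (norm h)\<^sup>2" using l by simp
    ultimately have "y - Q h / 2 \<le> 0" using y(2) by (simp add: abs_le_iff)
    then show ?thesis using y(1) by simp
  next
    case False
    then have "0 \<le> w x" "w x \<le> exp (- c * N)" using set by (auto simp: laplace_setting_def)
    moreover have "exp (- c * N) \<le> 1" using c N by simp
    ultimately show ?thesis by linarith
  qed
  then show "0 \<le> w x" "w x \<le> 1" by auto
qed

text \<open>Both integrals are written in the coordinate \<open>h = sqrt N *\<^sub>R (x - m)\<close>. The integrand is compared with
  the truncated centred Gaussian \<open>G'\<close>, whose first moment vanishes by symmetry. The difference is
  dominated by \<open>T\<close>: a polynomial times a Gaussian with a factor \<open>1 / sqrt N\<close> near the centre, and an
  exponentially small multiple of \<open>q\<close> elsewhere. Hence the first moment in \<open>h\<close> is $O(N^{-1/2})$. The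
  normalising constant stays away from zero because the integrand is bounded below on a fixed
  ball in \<open>h\<close>. Returning to \<open>x\<close> costs another factor $N^{-1/2}$. The constant \<open>K\<close> is chosen before
  the data-dependent quantities, so the bound is uniform in them.\<close>

lemma laplace_mean_bound:
  fixes l u C \<delta> c q0 q1 L D :: real
  assumes l: "0 < l" and C: "0 \<le> C" and \<delta>: "0 < \<delta>" and C\<delta>: "C * \<delta> \<le> l / 4" and c: "0 < c"
    and q0: "0 < q0" and q1: "0 \<le> q1" and L: "0 \<le> L" and D: "0 \<le> D"
  obtains K where "0 \<le> K"
    and "\<And>N (m::'a::euclidean_space) Q w q. laplace_setting l u C \<delta> c q0 q1 L D N m Q w q \<Longrightarrow>
           0 < (\<integral>x. w x * q x \<partial>lborel) \<and>
           norm (\<integral>x. (w x * q x) *\<^sub>R (x - m) \<partial>lborel) \<le> K / N * (\<integral>x. w x * q x \<partial>lborel)"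
proof -
  define p where "p = DIM('a)"
  define J where "J k = (\<integral>h. norm h ^ k * exp (- (l / 4) * (norm h)\<^sup>2) \<partial>(lborel::'a measure))" for k :: nat
  have Jint: "integrable lborel (\<lambda>h::'a. norm h ^ k * exp (- (l / 4) * (norm h)\<^sup>2))" for k
    by (rule integrable_gaussian_moment) (use l in simp)
  have J0: "0 \<le> J k" for k unfolding J_def by (intro integral_nonneg_AE) auto
  define A where "A = q1 * C * J 4 + L * J 2"
  \<comment> \<open>the tail term is $D\,e^{-c s^2} s^{p+1}$ with \<open>s = sqrt N\<close>; one more power of \<open>s\<close> is kept to gain the factor \<open>1 / s\<close>\<close>
  obtain E where E0: "0 < E" and E: "\<And>x. 0 \<le> x \<Longrightarrow> x ^ (p + 2) * exp (- c * x\<^sup>2) \<le> E"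
    using power_times_gaussian_bounded[OF c] by blast
  \<comment> \<open>lower bound of the integrand in \<open>h\<close> on the ball of radius \<open>\<delta>\<close>, which is inside the near region since \<open>1 \<le> N\<close>\<close>
  define \<kappa> where "\<kappa> = q0 * exp (- (u / 2 + l / 4) * \<delta>\<^sup>2)"
  define \<kappa>B where "\<kappa>B = \<kappa> * measure lborel (ball (0::'a) \<delta>)"
  have \<kappa>0: "0 < \<kappa>" using q0 by (simp add: \<kappa>_def)
  have \<kappa>B0: "0 < \<kappa>B"
    unfolding \<kappa>B_def using \<kappa>0 \<delta> by (simp add: content_ball_pos)
  define K where "K = (A + D * E) / \<kappa>B"
  have A0: "0 \<le> A" using q1 C L J0 by (simp add: A_def)
  have K0: "0 \<le> K" using A0 D E0 \<kappa>B0 by (simp add: K_def)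
  have main: "0 < (\<integral>x. w x * q x \<partial>lborel) \<and>
           norm (\<integral>x. (w x * q x) *\<^sub>R (x - m) \<partial>lborel) \<le> K / N * (\<integral>x. w x * q x \<partial>lborel)"
    if set: "laplace_setting l u C \<delta> c q0 q1 L D N m Q w q" for N and m :: 'a and Q w q
  proof -
    note setD = set[unfolded laplace_setting_def]
    have N: "1 \<le> N" and [measurable]: "Q \<in> borel_measurable borel" "w \<in> borel_measurable borel"
      and Qhom: "\<And>r h. Q (r *\<^sub>R h) = r\<^sup>2 * Q h"
      and Qlow: "\<And>h. l * (norm h)\<^sup>2 \<le> Q h" and Qup: "\<And>h. Q h \<le> u * (norm h)\<^sup>2"
      and far: "\<And>x. \<delta> \<le> norm (x - m) \<Longrightarrow> w x \<le> exp (- c * N)"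
      and q_nonneg: "\<And>x. 0 \<le> q x"
      and qnear: "\<And>x. norm (x - m) < \<delta> \<Longrightarrow> q0 \<le> q x \<and> q x \<le> q1 \<and> \<bar>q x - q m\<bar> \<le> L * norm (x - m)"
      and qint: "integrable lborel q" and qint1: "integrable lborel (\<lambda>x. norm (x - m) * q x)"
      and qD: "(\<integral>x. norm (x - m) * q x \<partial>lborel) \<le> D"
      using setD by blast+
    have [measurable]: "q \<in> borel_measurable borel" using qint by auto
    note w01 = laplace_weight_bounds[OF set l C C\<delta> c]
    define s where "s = sqrt N"
    have s1: "1 \<le> s" and sN: "s\<^sup>2 = N" using N by (auto simp: s_def)
    have c1: "1 / s \<noteq> 0" using s1 by simp
    define X where "X h = m + (1 / s) *\<^sub>R h" for h :: 'a
    have [measurable]: "X \<in> borel_measurable borel" unfolding X_def by measurable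
    have nX: "norm (X h - m) = norm h / s" for h using s1 by (simp add: X_def)
    define G where "G h = w (X h) * q (X h)" for h
    have [measurable]: "G \<in> borel_measurable borel" unfolding G_def by measurable
    have G0: "0 \<le> G h" for h by (simp add: G_def w01 q_nonneg)
    have Gq: "G h \<le> q (X h)" for h
      using mult_right_mono[OF w01(2) q_nonneg] by (simp add: G_def)
    define G' where "G' h = indicator (ball 0 (\<delta> * s)) h * (q m * exp (- Q h / 2))" for h :: 'a
    have [measurable]: "ball 0 (\<delta> * s) \<in> sets (borel :: 'a measure)" by simp
    have [measurable]: "G' \<in> borel_measurable borel" unfolding G'_def by simp
    have I0: "(\<integral>x. w x * q x \<partial>lborel) = (1 / s) ^ p * (\<integral>h. G h \<partial>lborel)"
      using integral_lborel_affine[of "\<lambda>x. w x * q x" "1 / s" m] s1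
      by (simp add: G_def X_def p_def)
    have I1: "(\<integral>x. (w x * q x) *\<^sub>R (x - m) \<partial>lborel) = (1 / s) ^ p *\<^sub>R (1 / s) *\<^sub>R (\<integral>h. G h *\<^sub>R h \<partial>lborel)"
    proof -
      have "(\<integral>x. (w x * q x) *\<^sub>R (x - m) \<partial>lborel)
          = \<bar>1 / s\<bar> ^ p *\<^sub>R (\<integral>h. G h *\<^sub>R ((1 / s) *\<^sub>R h) \<partial>lborel)"
        using integral_lborel_affine[of "\<lambda>x. (w x * q x) *\<^sub>R (x - m)" "1 / s" m] c1
        by (simp add: G_def X_def p_def)
      also have "(\<lambda>h. G h *\<^sub>R ((1 / s) *\<^sub>R h)) = (\<lambda>h. (1 / s) *\<^sub>R (G h *\<^sub>R h))"
        by (simp add: fun_eq_iff)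
      also have "(\<integral>h. (1 / s) *\<^sub>R (G h *\<^sub>R h) \<partial>lborel) = (1 / s) *\<^sub>R (\<integral>h. G h *\<^sub>R h \<partial>lborel)"
        by (rule integral_scaleR_right)
      finally show ?thesis using s1 by simp
    qed
    have qXint: "integrable lborel (\<lambda>h. q (X h))"
      unfolding X_def by (rule integrable_lborel_affine[OF qint c1])
    have "integrable lborel (\<lambda>h. s * (norm (X h - m) * q (X h)))"
      unfolding X_def by (intro integrable_mult_right integrable_lborel_affine[OF qint1 c1])
    then have qX1: "integrable lborel (\<lambda>h. norm h * q (X h))"
      unfolding nX using s1 by simp
    have qX1val: "(\<integral>h. norm h * q (X h) \<partial>lborel) \<le> D * s ^ (p + 1)"
    proof -
      have "(\<integral>x. norm (x - m) * q x \<partial>lborel) = (1 / s) ^ p * (\<integral>h. norm h / s * q (X h) \<partial>lborel)"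
        using integral_lborel_affine[of "\<lambda>x. norm (x - m) * q x" "1 / s" m] s1
        by (simp add: X_def p_def)
      also have "(\<integral>h. norm h / s * q (X h) \<partial>lborel) = (\<integral>h. norm h * q (X h) \<partial>lborel) / s"
        by simp
      finally have "(1 / s) ^ p * ((\<integral>h. norm h * q (X h) \<partial>lborel) / s) \<le> D" using qD by simp
      then show ?thesis using s1 by (simp add: field_simps power_divide)
    qed
    have Gint: "integrable lborel G"
      by (rule Bochner_Integration.integrable_bound[OF qXint]) (auto simp: G0 q_nonneg Gq)
    have "norm (G h *\<^sub>R h) \<le> norm (norm h * q (X h))" for h
      using mult_right_mono[OF Gq[of h] norm_ge_zero[of h]] G0[of h] q_nonneg[of "X h"]
      by (simp add: mult.commute abs_mult)
    then have G1int: "integrable lborel (\<lambda>h. G h *\<^sub>R h)"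
      by (intro Bochner_Integration.integrable_bound[OF qX1]) auto
    have qm: "q0 \<le> q m" "q m \<le> q1" using qnear[of m] \<delta> by auto
    have gauss: "exp (- Q h / 2) \<le> exp (- (l / 4) * (norm h)\<^sup>2)" for h
    proof -
      have "0 \<le> l * (norm h)\<^sup>2" using l by simp
      then have "- Q h / 2 \<le> - (l / 4) * (norm h)\<^sup>2" using Qlow[of h] by simp
      then show ?thesis by simp
    qed
    have G'1int: "integrable lborel (\<lambda>h. G' h *\<^sub>R h)"
    proof (rule Bochner_Integration.integrable_bound)
      show "integrable lborel (\<lambda>h::'a. q1 * (norm h ^ 1 * exp (- (l / 4) * (norm h)\<^sup>2)))"
        by (intro integrable_mult_right Jint)
      show "AE h in lborel. norm (G' h *\<^sub>R h) \<le> norm (q1 * (norm h ^ 1 * exp (- (l / 4) * (norm h)\<^sup>2)))"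
      proof (rule AE_I2)
        fix h :: 'a
        have "\<bar>G' h\<bar> \<le> q m * exp (- Q h / 2)"
          using q_nonneg[of m] by (auto simp: G'_def indicator_def)
        also have "\<dots> \<le> q1 * exp (- (l / 4) * (norm h)\<^sup>2)"
          using q1 qm gauss by (intro mult_mono) auto
        finally have "\<bar>G' h\<bar> * norm h \<le> q1 * exp (- (l / 4) * (norm h)\<^sup>2) * norm h"
          by (intro mult_right_mono) auto
        then show "norm (G' h *\<^sub>R h) \<le> norm (q1 * (norm h ^ 1 * exp (- (l / 4) * (norm h)\<^sup>2)))"
          using q1 by (simp add: abs_mult mult_ac)
      qed
    qed auto
    have G'1: "(\<integral>h. G' h *\<^sub>R h \<partial>lborel) = 0"
    proof (rule integral_odd_eq_0)
      have "Q (- h) = Q h" for h using Qhom[of "-1" h] by simp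
      then show "G' (- h) *\<^sub>R - h = - (G' h *\<^sub>R h)" for h
        by (simp add: G'_def indicator_def)
    qed measurable
    have "\<kappa> * indicator (ball 0 \<delta>) h \<le> G h" for h
    proof (cases "norm h < \<delta>")
      case True
      then have h: "norm h < \<delta> * s" using s1 \<delta>
        by (smt (verit) mult_le_cancel_left1)
      obtain y where y: "w (X h) = exp (y - Q h / 2)" "\<bar>y\<bar> \<le> l / 4 * (norm h)\<^sup>2"
        using laplace_near[OF set C C\<delta> s_def h] by (auto simp: X_def)
      have "(norm h)\<^sup>2 \<le> \<delta>\<^sup>2" using True by (intro power_mono) auto
      have "0 \<le> u"
      proof -
        obtain b :: 'a where "b \<in> Basis" using nonempty_Basis by blast
        then show ?thesis using Qlow[of b] Qup[of b] l by simp
      qed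
      have "- (y - Q h / 2) \<le> (u / 2 + l / 4) * (norm h)\<^sup>2"
        using y(2) Qup[of h] by (simp add: algebra_simps abs_le_iff)
      also have "\<dots> \<le> (u / 2 + l / 4) * \<delta>\<^sup>2"
        using \<open>0 \<le> u\<close> l \<open>(norm h)\<^sup>2 \<le> \<delta>\<^sup>2\<close> by (intro mult_left_mono) auto
      finally have "exp (- (u / 2 + l / 4) * \<delta>\<^sup>2) \<le> w (X h)"
        unfolding y(1) exp_le_cancel_iff by linarith
      moreover have "q0 \<le> q (X h)"
        using qnear[of "X h"] h s1 by (auto simp: nX field_simps)
      ultimately have "\<kappa> \<le> G h"
        unfolding \<kappa>_def G_def using q0 w01 by (subst mult.commute) (intro mult_mono, auto)
      then show ?thesis using True by simp
    next
      case False
      then show ?thesis using G0 by simp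
    qed
    then have "(\<integral>h. \<kappa> * indicator (ball 0 \<delta>) h \<partial>(lborel::'a measure)) \<le> (\<integral>h. G h \<partial>lborel)"
      using Gint emeasure_bounded_finite[OF bounded_ball, of "0::'a" \<delta>]
      by (intro integral_mono) (auto simp: less_top)
    then have low: "\<kappa>B \<le> (\<integral>h. G h \<partial>lborel)" by (simp add: \<kappa>B_def)
    \<comment> \<open>a single majorant for both regions: its first part bounds the difference near the centre, its second part bounds \<open>G\<close> far away, where the truncated Gaussian vanishes\<close>
    define T where "T h = (1 / s) * (q1 * C * (norm h ^ 4 * exp (- (l / 4) * (norm h)\<^sup>2))
          + L * (norm h ^ 2 * exp (- (l / 4) * (norm h)\<^sup>2))) + exp (- c * N) * (norm h * q (X h))" for h
    have cmp: "\<bar>G h - G' h\<bar> * norm h \<le> T h" for h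
    proof (cases "norm h < \<delta> * s")
      case True
      define z where "z = - (l / 4) * (norm h)\<^sup>2"
      obtain y where y: "w (X h) = exp (y - Q h / 2)" "\<bar>y\<bar> \<le> C * norm h ^ 3 / s" "\<bar>y\<bar> \<le> l / 4 * (norm h)\<^sup>2"
        using laplace_near[OF set C C\<delta> s_def True] by (auto simp: X_def)
      have "norm (X h - m) < \<delta>" using True s1 by (simp add: nX field_simps)
      note qh = qnear[OF this, unfolded nX]
      have "\<bar>w (X h) - exp (- Q h / 2)\<bar> \<le> \<bar>(y - Q h / 2) - (- Q h / 2)\<bar> * exp z"
        unfolding y(1)
      proof (rule abs_exp_diff_le)
        show "y - Q h / 2 \<le> z" "- Q h / 2 \<le> z"
          using y(3) Qlow[of h] l by (auto simp: z_def abs_le_iff)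
      qed
      also have "\<dots> \<le> C * norm h ^ 3 / s * exp z" using y(2) by (intro mult_right_mono) auto
      finally have wz: "\<bar>w (X h) - exp (- Q h / 2)\<bar> \<le> C * norm h ^ 3 / s * exp z" .
      have "\<bar>G h - G' h\<bar> = \<bar>(w (X h) - exp (- Q h / 2)) * q (X h) + exp (- Q h / 2) * (q (X h) - q m)\<bar>"
        using True by (simp add: G_def G'_def algebra_simps)
      also have "\<dots> \<le> \<bar>w (X h) - exp (- Q h / 2)\<bar> * q (X h) + exp (- Q h / 2) * \<bar>q (X h) - q m\<bar>"
        using abs_triangle_ineq[of "(w (X h) - exp (- Q h / 2)) * q (X h)" "exp (- Q h / 2) * (q (X h) - q m)"]
          q_nonneg[of "X h"] by (simp add: abs_mult)
      also have "\<dots> \<le> (C * norm h ^ 3 / s * exp z) * q1 + exp z * (L * (norm h / s))"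
        using wz qh gauss[of h] q_nonneg C L s1 by (intro add_mono mult_mono) (auto simp: z_def)
      finally have "\<bar>G h - G' h\<bar> * norm h
          \<le> ((C * norm h ^ 3 / s * exp z) * q1 + exp z * (L * (norm h / s))) * norm h"
        by (intro mult_right_mono) auto
      also have "\<dots> = (1 / s) * (q1 * C * (norm h ^ 4 * exp z) + L * (norm h ^ 2 * exp z))"
        using s1 by (simp add: field_simps power2_eq_square power3_eq_cube power4_eq_xxxx)
      also have "\<dots> \<le> T h" unfolding T_def z_def using q_nonneg by simp
      finally show ?thesis .
    next
      case False
      then have "\<delta> \<le> norm (X h - m)" using s1 by (simp add: nX field_simps)
      then have "G h \<le> exp (- c * N) * q (X h)"
        unfolding G_def using q_nonneg by (intro mult_right_mono far) auto
      then have "\<bar>G h - G' h\<bar> * norm h \<le> exp (- c * N) * q (X h) * norm h"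
        using False G0 by (intro mult_right_mono) (auto simp: G'_def)
      also have "\<dots> \<le> T h" unfolding T_def using q1 C L s1 by (simp add: mult_ac)
      finally show ?thesis .
    qed
    have Tint: "integrable lborel T"
      unfolding T_def using Jint[of 4] Jint[of 2] qX1 by (intro Bochner_Integration.integrable_add integrable_mult_right) auto
    have "(\<integral>h. T h \<partial>lborel) = (1 / s) * (q1 * C * J 4 + L * J 2) + exp (- c * N) * (\<integral>h. norm h * q (X h) \<partial>lborel)"
      unfolding T_def J_def using Jint[of 4] Jint[of 2] qX1
      by (simp only: Bochner_Integration.integral_add Bochner_Integration.integral_mult_right_zero Bochner_Integration.integrable_add integrable_mult_right)
    also have "\<dots> \<le> (1 / s) * A + exp (- c * N) * (D * s ^ (p + 1))"
      unfolding A_def by (intro add_left_mono mult_left_mono qX1val) auto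
    also have "exp (- c * N) * (D * s ^ (p + 1)) = (1 / s) * D * (s ^ (p + 2) * exp (- c * s\<^sup>2))"
      using s1 by (simp add: sN)
    also have "\<dots> \<le> (1 / s) * D * E"
      using s1 D E[of s] by (intro mult_left_mono) auto
    finally have Tval: "(\<integral>h. T h \<partial>lborel) \<le> (A + D * E) / s" by (simp add: add_divide_distrib)
    have "norm (\<integral>h. G h *\<^sub>R h \<partial>lborel) = norm (\<integral>h. G h *\<^sub>R h - G' h *\<^sub>R h \<partial>lborel)"
      using G1int G'1int G'1 by simp
    also have "\<dots> \<le> (\<integral>h. norm (G h *\<^sub>R h - G' h *\<^sub>R h) \<partial>lborel)" by (rule integral_norm_bound)
    also have "\<dots> \<le> (\<integral>h. T h \<partial>lborel)"
    proof (rule integral_mono[OF integrable_norm[OF Bochner_Integration.integrable_diff[OF G1int G'1int]] Tint])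
      show "norm (G h *\<^sub>R h - G' h *\<^sub>R h) \<le> T h" for h
        using cmp[of h] by (simp flip: scaleR_left_diff_distrib)
    qed
    also have "\<dots> \<le> (A + D * E) / s" by (rule Tval)
    also have "\<dots> = K * \<kappa>B / s" using \<kappa>B0 by (simp add: K_def)
    also have "\<dots> \<le> K * (\<integral>h. G h \<partial>lborel) / s"
      using K0 s1 low by (intro divide_right_mono mult_left_mono) auto
    finally have fin: "norm (\<integral>h. G h *\<^sub>R h \<partial>lborel) \<le> K * (\<integral>h. G h \<partial>lborel) / s" .
    have "norm (\<integral>x. (w x * q x) *\<^sub>R (x - m) \<partial>lborel) = (1 / s) ^ p * (1 / s) * norm (\<integral>h. G h *\<^sub>R h \<partial>lborel)"
      unfolding I1 using s1 by simp
    also have "\<dots> \<le> (1 / s) ^ p * (1 / s) * (K * (\<integral>h. G h \<partial>lborel) / s)"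
      using s1 by (intro mult_left_mono fin) auto
    also have "\<dots> = K / N * (\<integral>x. w x * q x \<partial>lborel)"
      unfolding I0 sN[symmetric] by (simp add: power2_eq_square)
    finally show ?thesis using low \<kappa>B0 s1 unfolding I0 by simp
  qed
  show ?thesis by (rule that[OF K0 main])
qed

lemma laplace_integrable:
  fixes m :: "'a::euclidean_space"
  assumes set: "laplace_setting l u C \<delta> c q0 q1 L D N m Q w q"
    and l: "0 < l" and C: "0 \<le> C" and C\<delta>: "C * \<delta> \<le> l / 4" and c: "0 < c"
  shows "integrable lborel (\<lambda>x. w x * q x)" "integrable lborel (\<lambda>x. (w x * q x) *\<^sub>R (x - m))"
proof -
  have [measurable]: "w \<in> borel_measurable borel" and q_nonneg: "\<And>x. 0 \<le> q x"
    and qint: "integrable lborel q" and qint1: "integrable lborel (\<lambda>x. norm (x - m) * q x)"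
    using set unfolding laplace_setting_def by blast+
  have [measurable]: "q \<in> borel_measurable borel" using qint by auto
  have wq: "0 \<le> w x * q x" "w x * q x \<le> q x" for x
    using laplace_weight_bounds[OF set l C C\<delta> c, of x] q_nonneg[of x]
      mult_right_mono[of "w x" 1 "q x"] by auto
  show "integrable lborel (\<lambda>x. w x * q x)"
    by (rule Bochner_Integration.integrable_bound[OF qint]) (use wq q_nonneg in auto)
  have "norm ((w x * q x) *\<^sub>R (x - m)) \<le> norm (norm (x - m) * q x)" for x
    using mult_right_mono[OF wq(2)[of x] norm_ge_zero[of "x - m"]] wq(1)[of x] q_nonneg[of x]
    by (metis norm_scaleR real_norm_def abs_of_nonneg mult.commute mult_nonneg_nonneg norm_ge_zero)
  then show "integrable lborel (\<lambda>x. (w x * q x) *\<^sub>R (x - m))"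
    by (intro Bochner_Integration.integrable_bound[OF qint1]) auto
qed

section \<open>Events of high probability and convergence in distribution\<close>

text \<open>The exceptional event is required to lie in a measurable set of small probability, although the
  event itself need not be measurable. This makes finite intersections of such statements
  accessible to ordinary subadditivity, and it is how the assumptions in terms of outer
  probabilities are used.\<close>

definition eventually_likely :: "(nat \<Rightarrow> 'a measure) \<Rightarrow> real \<Rightarrow> (nat \<Rightarrow> 'a \<Rightarrow> bool) \<Rightarrow> bool" where
  "eventually_likely P \<epsilon> G \<longleftrightarrow> (\<forall>\<^sub>F n in sequentially. \<exists>B\<in>sets (P n).
     emeasure (P n) B < ennreal \<epsilon> \<and> (\<forall>x\<in>space (P n) - B. G n x))"

text \<open>The outer measure of a set is attained by a measurable superset.\<close>

lemma eventually_likely_outer_prob: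
  assumes "\<forall>\<^sub>F n in sequentially. outer_prob (P n) (\<lambda>x. \<not> G n x) < ennreal \<epsilon>"
  shows "eventually_likely P \<epsilon> G"
  unfolding eventually_likely_def using assms
proof eventually_elim
  case (elim n)
  obtain B where "B \<in> sets (P n)" "{x \<in> space (P n). \<not> G n x} \<subseteq> B"
    "outer_prob (P n) (\<lambda>x. \<not> G n x) = emeasure (P n) B"
    using outer_measure_of_attain[of "{x \<in> space (P n). \<not> G n x}" "P n"]
    by (auto simp: outer_prob_def)
  with elim show ?case by (intro bexI[of _ B]) auto
qed

lemma eventually_likely_not:
  assumes "\<forall>\<^sub>F n in sequentially. outer_prob (P n) (E n) < ennreal \<epsilon>"
  shows "eventually_likely P \<epsilon> (\<lambda>n x. \<not> E n x)"
  by (rule eventually_likely_outer_prob) (simp add: assms)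

lemma eventually_likely_outer_prob_tendsto:
  assumes "(\<lambda>n. outer_prob (P n) (\<lambda>x. \<not> G n x)) \<longlonglongrightarrow> 0" and "0 < \<epsilon>"
  shows "eventually_likely P \<epsilon> G"
  using order_tendstoD(2)[OF assms(1), of "ennreal \<epsilon>"] assms(2)
  by (intro eventually_likely_outer_prob) simp

lemma eventually_likely_AE:
  assumes "\<And>n. 1 \<le> n \<Longrightarrow> AE x in P n. G n x" and "0 < \<epsilon>"
  shows "eventually_likely P \<epsilon> G"
  unfolding eventually_likely_def
proof (rule eventually_sequentiallyI)
  fix n :: nat assume "1 \<le> n"
  from AE_E3[OF assms(1)[OF this]] obtain B where "B \<in> null_sets (P n)" "\<And>x. x \<in> space (P n) - B \<Longrightarrow> G n x"
    by blast
  then show "\<exists>B\<in>sets (P n). emeasure (P n) B < ennreal \<epsilon> \<and> (\<forall>x\<in>space (P n) - B. G n x)"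
    using \<open>0 < \<epsilon>\<close> by (intro bexI[of _ B]) auto
qed

lemma eventually_likely_conj:
  assumes "eventually_likely P \<epsilon> G" "eventually_likely P \<epsilon>' G'"
  shows "eventually_likely P (\<epsilon> + \<epsilon>') (\<lambda>n x. G n x \<and> G' n x)"
  using assms unfolding eventually_likely_def
proof eventually_elim
  case (elim n)
  then obtain B B' where B: "B \<in> sets (P n)" "emeasure (P n) B < ennreal \<epsilon>" "\<forall>x\<in>space (P n) - B. G n x"
    and B': "B' \<in> sets (P n)" "emeasure (P n) B' < ennreal \<epsilon>'" "\<forall>x\<in>space (P n) - B'. G' n x"
    by blast
  have "emeasure (P n) (B \<union> B') \<le> emeasure (P n) B + emeasure (P n) B'"
    using B(1) B'(1) by (rule emeasure_subadditive)
  also have "\<dots> < ennreal \<epsilon> + ennreal \<epsilon>'" using B(2) B'(2) by (rule add_strict_mono)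
  also have "\<dots> = ennreal (\<epsilon> + \<epsilon>')"
    using le_less_trans[OF zero_le B(2)] le_less_trans[OF zero_le B'(2)] by simp
  finally show ?case using B B' by (intro bexI[of _ "B \<union> B'"]) auto
qed

lemma eventually_likely_mono:
  assumes "eventually_likely P \<epsilon> G" and "\<forall>\<^sub>F n in sequentially. A n"
    and "\<And>n x. A n \<Longrightarrow> x \<in> space (P n) \<Longrightarrow> G n x \<Longrightarrow> G' n x"
  shows "eventually_likely P \<epsilon> G'"
  using assms(1,2) unfolding eventually_likely_def
proof eventually_elim
  case (elim n)
  then show ?case using assms(3)[of n] by (meson DiffD1)
qed

text \<open>The constant function 1 is a bounded continuous test function, so no mass can be lost in the limit.\<close>

lemma prob_space_tends_in_distr:
  fixes \<mu> :: "(real ^ 'p) measure"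
  assumes prob: "\<And>n. 1 \<le> n \<Longrightarrow> prob_space (P n)"
    and Y: "tends_in_distr P Y \<mu>"
  shows "prob_space \<mu>"
proof
  have "(\<lambda>n. \<integral>x. (1::real) \<partial>P n) \<longlonglongrightarrow> (\<integral>y. 1 \<partial>\<mu>)"
    using Y unfolding tends_in_distr_def by (auto dest: spec[of _ "\<lambda>_. 1"])
  moreover have "(\<lambda>n. \<integral>x. (1::real) \<partial>P n) \<longlonglongrightarrow> 1"
  proof (rule tendsto_eventually, rule eventually_sequentiallyI)
    fix n :: nat assume "1 \<le> n"
    then interpret prob_space "P n" by (rule prob)
    show "(\<integral>x. (1::real) \<partial>P n) = 1" using prob_space by simp
  qed
  ultimately have "measure \<mu> (space \<mu>) = 1"
    using LIMSEQ_unique by fastforce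
  then show "emeasure \<mu> (space \<mu>) = 1"
    by (metis ennreal_1 ennreal_enn2real_if enn2real_top measure_def zero_neq_one)
qed

text \<open>The limit law gives little mass to the complement of a large ball. A continuous function that
  interpolates between the indicators of two such complements transfers this to the approximating
  laws.\<close>

lemma tends_in_distr_tight:
  fixes \<mu> :: "(real ^ 'p) measure"
  assumes prob: "\<And>n. 1 \<le> n \<Longrightarrow> prob_space (P n)"
    and Y: "tends_in_distr P Y \<mu>" and sets\<mu> [measurable_cong]: "sets \<mu> = sets borel" and \<epsilon>: "0 < \<epsilon>"
  obtains R where "\<forall>\<^sub>F n in sequentially. measure (P n) {x \<in> space (P n). R \<le> norm (Y n x)} < \<epsilon>"
proof -
  interpret \<mu>: prob_space \<mu> using prob_space_tends_in_distr[OF prob Y] .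
  have space\<mu>: "space \<mu> = UNIV" using sets_eq_imp_space_eq[OF sets\<mu>] by simp
  define A where "A k = {y :: real ^ 'p. real k \<le> norm y}" for k :: nat
  have [measurable]: "A k \<in> sets borel" for k unfolding A_def by measurable
  have "(\<lambda>k. measure \<mu> (A k)) \<longlonglongrightarrow> measure \<mu> (\<Inter>k. A k)"
  proof (rule \<mu>.finite_Lim_measure_decseq)
    show "range A \<subseteq> sets \<mu>" by (auto simp: sets\<mu>)
    show "decseq A" by (auto simp: decseq_def A_def)
  qed
  moreover have "(\<Inter>k. A k) = {}"
  proof -
    have "\<exists>k. y \<notin> A k" for y
      using reals_Archimedean2[of "norm y"] by (auto simp: A_def not_le)
    then show ?thesis by blast
  qed
  ultimately have "(\<lambda>k. measure \<mu> (A k)) \<longlonglongrightarrow> 0" by simp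
  then have "\<forall>\<^sub>F k in sequentially. measure \<mu> (A k) < \<epsilon>" using \<epsilon> by (rule order_tendstoD)
  then obtain k where k: "measure \<mu> (A k) < \<epsilon>" by (auto simp: eventually_sequentially)
  define \<phi> where "\<phi> y = min 1 (max 0 (norm y - real k))" for y :: "real ^ 'p"
  have cont: "continuous_on UNIV \<phi>" unfolding \<phi>_def by (intro continuous_intros)
  have b01: "0 \<le> \<phi> y" "\<phi> y \<le> 1" for y by (auto simp: \<phi>_def)
  have bdd: "bounded (range \<phi>)" unfolding bounded_iff using b01 by (intro exI[of _ 1]) auto
  have [measurable]: "\<phi> \<in> borel_measurable borel" using cont by (rule borel_measurable_continuous_onI)
  have "(\<integral>y. \<phi> y \<partial>\<mu>) \<le> (\<integral>y. indicator (A k) y \<partial>\<mu>)"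
  proof (rule integral_mono)
    show "integrable \<mu> \<phi>" using b01 by (intro \<mu>.integrable_const_bound[of _ 1]) auto
    show "integrable \<mu> (indicator (A k) :: _ \<Rightarrow> real)"
      by (intro \<mu>.integrable_const_bound[of _ 1]) (auto simp: indicator_def)
    show "\<phi> y \<le> indicator (A k) y" for y by (auto simp: \<phi>_def A_def indicator_def)
  qed
  also have "\<dots> = measure \<mu> (A k)" by (simp add: space\<mu>)
  also have "\<dots> < \<epsilon>" by (rule k)
  finally have lim: "(\<integral>y. \<phi> y \<partial>\<mu>) < \<epsilon>" .
  have conv: "(\<lambda>n. \<integral>x. \<phi> (Y n x) \<partial>P n) \<longlonglongrightarrow> (\<integral>y. \<phi> y \<partial>\<mu>)"
    using Y cont bdd unfolding tends_in_distr_def by blast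
  have meas: "\<forall>\<^sub>F n in sequentially. Y n \<in> borel_measurable (P n)"
    using Y unfolding tends_in_distr_def by blast
  have "\<forall>\<^sub>F n in sequentially. measure (P n) {x \<in> space (P n). real k + 1 \<le> norm (Y n x)} < \<epsilon>"
    using meas order_tendstoD(2)[OF conv lim] eventually_ge_at_top[of 1]
  proof eventually_elim
    case (elim n)
    interpret prob_space "P n" using elim(3) by (rule prob)
    note [measurable] = elim(1)
    have "measure (P n) {x \<in> space (P n). real k + 1 \<le> norm (Y n x)}
        = (\<integral>x. indicator {x \<in> space (P n). real k + 1 \<le> norm (Y n x)} x \<partial>P n)"
      by (simp add: Int_absorb1 subset_eq)
    also have "\<dots> \<le> (\<integral>x. \<phi> (Y n x) \<partial>P n)"
    proof (rule integral_mono)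
      show "integrable (P n) (\<lambda>x. \<phi> (Y n x))" using b01 by (intro integrable_const_bound[of _ 1]) auto
      show "integrable (P n) (indicator {x \<in> space (P n). real k + 1 \<le> norm (Y n x)} :: _ \<Rightarrow> real)"
        by (intro integrable_const_bound[of _ 1]) (auto simp: indicator_def)
      show "indicator {x \<in> space (P n). real k + 1 \<le> norm (Y n x)} x \<le> \<phi> (Y n x)" for x
        by (auto simp: \<phi>_def indicator_def)
    qed
    finally show ?case using elim(2) by simp
  qed
  then show ?thesis by (rule that)
qed

text \<open>Slutsky's lemma for an additive perturbation. A bounded continuous test function is uniformly
  continuous only on compact sets, so tightness of \<open>Y\<close> is used to confine both sequences to a ball;
  outside, the boundedness of the test function and the smallness of the probability suffice.\<close>

lemma tends_in_distr_perturb: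
  fixes \<mu> :: "(real ^ 'p) measure"
  assumes prob: "\<And>n. 1 \<le> n \<Longrightarrow> prob_space (P n)"
    and Y: "tends_in_distr P Y \<mu>" and sets\<mu>: "sets \<mu> = sets borel"
    and Z: "\<And>n. 1 \<le> n \<Longrightarrow> Z n \<in> borel_measurable (P n)"
    and close: "\<And>\<epsilon> \<eta>. 0 < \<epsilon> \<Longrightarrow> 0 < \<eta> \<Longrightarrow> eventually_likely P \<epsilon> (\<lambda>n x. dist (Z n x) (Y n x) < \<eta>)"
  shows "tends_in_distr P Z \<mu>"
  unfolding tends_in_distr_def
proof (intro conjI allI impI)
  show "\<forall>\<^sub>F n in sequentially. Z n \<in> borel_measurable (P n)"
    using Z by (auto simp: eventually_sequentially)
next
  fix g :: "real ^ 'p \<Rightarrow> real"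
  assume cont: "continuous_on UNIV g" and bdd: "bounded (range g)"
  obtain b where b: "\<And>y. \<bar>g y\<bar> \<le> b" using bdd by (auto simp: bounded_iff)
  have b0: "0 \<le> b" using b[of 0] by linarith
  have [measurable]: "g \<in> borel_measurable borel" using cont by (rule borel_measurable_continuous_onI)
  have meas: "\<forall>\<^sub>F n in sequentially. Y n \<in> borel_measurable (P n)"
    using Y unfolding tends_in_distr_def by blast
  have conv: "(\<lambda>n. \<integral>x. g (Y n x) \<partial>P n) \<longlonglongrightarrow> (\<integral>y. g y \<partial>\<mu>)"
    using Y cont bdd unfolding tends_in_distr_def by blast
  have "(\<lambda>n. (\<integral>x. g (Z n x) \<partial>P n) - (\<integral>x. g (Y n x) \<partial>P n)) \<longlonglongrightarrow> 0"
  proof (rule tendstoI)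
    fix e :: real assume "0 < e"
    define \<epsilon> where "\<epsilon> = e / (2 * (1 + 4 * b))"
    have \<epsilon>: "0 < \<epsilon>" using \<open>0 < e\<close> b0 by (simp add: \<epsilon>_def)
    obtain R where R: "\<forall>\<^sub>F n in sequentially. measure (P n) {x \<in> space (P n). R \<le> norm (Y n x)} < \<epsilon>"
      using tends_in_distr_tight[OF prob Y sets\<mu> \<epsilon>] by blast
    have "uniformly_continuous_on (cball 0 (R + 1)) g"
      using cont by (intro compact_uniformly_continuous continuous_on_subset[OF cont]) auto
    then obtain d where d: "0 < d"
      "\<And>y z. y \<in> cball 0 (R + 1) \<Longrightarrow> z \<in> cball 0 (R + 1) \<Longrightarrow> dist z y < d \<Longrightarrow> dist (g z) (g y) < \<epsilon>"
      using \<epsilon> unfolding uniformly_continuous_on_def by metis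
    have "eventually_likely P \<epsilon> (\<lambda>n x. dist (Z n x) (Y n x) < min d 1)"
      using \<epsilon> d(1) by (intro close) auto
    then show "\<forall>\<^sub>F n in sequentially. dist ((\<integral>x. g (Z n x) \<partial>P n) - (\<integral>x. g (Y n x) \<partial>P n)) 0 < e"
      using R meas eventually_ge_at_top[of 1] unfolding eventually_likely_def
    proof eventually_elim
      case (elim n)
      interpret prob_space "P n" using elim(4) by (rule prob)
      note [measurable] = elim(3) Z[OF elim(4)]
      obtain B where [measurable]: "B \<in> sets (P n)" and B: "emeasure (P n) B < ennreal \<epsilon>"
        "\<And>x. x \<in> space (P n) \<Longrightarrow> x \<notin> B \<Longrightarrow> dist (Z n x) (Y n x) < min d 1"
        using elim(1) by blast
      have mB: "measure (P n) B < \<epsilon>"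
        using B(1) \<epsilon> by (simp add: emeasure_eq_measure ennreal_less_iff)
      define F where "F = {x \<in> space (P n). R \<le> norm (Y n x)}"
      have [measurable]: "F \<in> sets (P n)" unfolding F_def by measurable
      have intY: "integrable (P n) (\<lambda>x. g (Y n x))" and intZ: "integrable (P n) (\<lambda>x. g (Z n x))"
        using b by (auto intro!: integrable_const_bound[of _ b])
      have intB: "integrable (P n) (indicator B :: _ \<Rightarrow> real)" and intF: "integrable (P n) (indicator F :: _ \<Rightarrow> real)"
        by (auto intro!: integrable_const_bound[of _ 1] simp: indicator_def)
      have ptw: "\<bar>g (Z n x) - g (Y n x)\<bar> \<le> \<epsilon> + 2 * b * (indicator B x + indicator F x)"
        if x: "x \<in> space (P n)" for x
      proof (cases "x \<in> B \<or> x \<in> F")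
        case True
        then have "2 * b * 1 \<le> 2 * b * (indicator B x + indicator F x)"
          using b0 by (intro mult_left_mono) (auto simp: indicator_def)
        then show ?thesis using b[of "Z n x"] b[of "Y n x"] \<epsilon> by (simp add: abs_le_iff)
      next
        case False
        then have Yx: "norm (Y n x) < R" and D: "dist (Z n x) (Y n x) < d" "dist (Z n x) (Y n x) < 1"
          using x B(2)[OF x] by (auto simp: F_def)
        have "norm (Z n x) \<le> R + 1"
          using norm_triangle_ineq2[of "Z n x" "Y n x"] Yx D(2) by (simp add: dist_norm)
        then have "dist (g (Z n x)) (g (Y n x)) < \<epsilon>"
          using Yx D(1) by (intro d(2)) auto
        then show ?thesis using False by (simp add: dist_real_def)
      qed
      have "\<bar>(\<integral>x. g (Z n x) \<partial>P n) - (\<integral>x. g (Y n x) \<partial>P n)\<bar> = \<bar>\<integral>x. g (Z n x) - g (Y n x) \<partial>P n\<bar>"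
        using intY intZ by simp
      also have "\<dots> \<le> (\<integral>x. \<bar>g (Z n x) - g (Y n x)\<bar> \<partial>P n)" by (rule integral_abs_bound)
      also have "\<dots> \<le> (\<integral>x. \<epsilon> + 2 * b * (indicator B x + indicator F x) \<partial>P n)"
        using intY intZ intB intF ptw
        by (intro integral_mono Bochner_Integration.integrable_add integrable_mult_right) auto
      also have "\<dots> = \<epsilon> + 2 * b * (measure (P n) B + measure (P n) F)"
      proof -
        have "(\<integral>x. \<epsilon> + 2 * b * (indicator B x + indicator F x) \<partial>P n)
            = (\<integral>x. \<epsilon> \<partial>P n) + 2 * b * ((\<integral>x. indicator B x \<partial>P n) + (\<integral>x. indicator F x \<partial>P n))"
          using intB intF by (subst Bochner_Integration.integral_add) auto
        then show ?thesis by (simp add: prob_space)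
      qed
      also have "\<dots> \<le> \<epsilon> + 2 * b * (\<epsilon> + \<epsilon>)"
        using mB elim(2) b0 unfolding F_def[symmetric] by (intro add_left_mono mult_left_mono) auto
      also have "\<dots> = \<epsilon> * (1 + 4 * b)" by (simp add: algebra_simps)
      also have "\<dots> = e / 2" using b0 by (simp add: \<epsilon>_def field_simps)
      also have "\<dots> < e" using \<open>0 < e\<close> by simp
      finally show ?case by (simp add: dist_real_def)
    qed
  qed
  from tendsto_add[OF this conv] show "(\<lambda>n. \<integral>x. g (Z n x) \<partial>P n) \<longlonglongrightarrow> (\<integral>y. g y \<partial>\<mu>)" by simp
qed

section \<open>The posterior as a Laplace integral\<close>

lemma likelihood_nonneg:
  assumes "statistical_model \<X> \<nu> f0 f \<Theta>" "1 \<le> n" "x \<in> space (sample_measure \<nu> n)"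
  shows "0 \<le> likelihood f \<Theta> n x \<theta>"
  using assms by (auto simp: statistical_model_def likelihood_def is_density_def)

text \<open>Only the prior restricted to \<open>\<Theta>\<close> is known to be measurable and integrable. It may replace the
  prior because \<open>0 powr a = 0\<close>.\<close>

lemma likelihood_powr_prior:
  "likelihood f \<Theta> n x \<theta> powr a * \<pi> \<theta> = likelihood f \<Theta> n x \<theta> powr a * (indicator \<Theta> \<theta> * \<pi> \<theta>)"
  by (simp add: likelihood_def)

text \<open>Convergence in distribution includes measurability of the estimator as a function of the data. Both
  the posterior mean and its normalising constant are parameter integrals of jointly measurable
  functions.\<close>

lemma measurable_posterior_mean:
  fixes \<Theta> :: "(real ^ 'p) set"
  assumes model: "statistical_model \<X> \<nu> f0 f \<Theta>" and prior: "is_prior \<Theta> \<pi>" and n: "1 \<le> n"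
    and [measurable]: "a \<in> borel_measurable (sample_measure \<nu> n)"
  shows "(\<lambda>x. posterior_mean f \<Theta> \<pi> n (a x) x) \<in> borel_measurable (sample_measure \<nu> n)"
proof -
  define q where "q \<theta> = indicator \<Theta> \<theta> * \<pi> \<theta>" for \<theta>
  have [measurable]: "q \<in> borel_measurable borel"
    using prior by (simp add: is_prior_def is_density_def q_def[abs_def])
  have "(\<lambda>(x, \<theta>). likelihood f \<Theta> n x \<theta>) \<in> borel_measurable (sample_measure \<nu> n \<Otimes>\<^sub>M borel)"
    using model n by (simp add: statistical_model_def)
  also have "borel_measurable (sample_measure \<nu> n \<Otimes>\<^sub>M borel)
      = borel_measurable (sample_measure \<nu> n \<Otimes>\<^sub>M (lborel :: (real ^ 'p) measure))"
    by (intro measurable_cong_sets sets_pair_measure_cong) auto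
  finally have [measurable]: "(\<lambda>(x, \<theta>). likelihood f \<Theta> n x \<theta>)
      \<in> borel_measurable (sample_measure \<nu> n \<Otimes>\<^sub>M (lborel :: (real ^ 'p) measure))" .
  have [measurable]: "(\<lambda>x. \<integral>t. likelihood f \<Theta> n x t powr a x * q t \<partial>lborel)
      \<in> borel_measurable (sample_measure \<nu> n)"
    by measurable
  have eq: "likelihood f \<Theta> n x \<theta> powr b * \<pi> \<theta> = likelihood f \<Theta> n x \<theta> powr b * q \<theta>" for x \<theta> b
    unfolding q_def by (rule likelihood_powr_prior)
  show ?thesis unfolding posterior_mean_def posterior_density_def eq by measurable
qed

text \<open>Twice continuous differentiability is used through the boundedness of the gradient on a compact
  ball, which gives a Lipschitz constant.\<close>

lemma prior_bounds_near:
  assumes "assm_A1' \<Theta> \<pi> \<theta>star" and "open \<Theta>" "\<theta>star \<in> \<Theta>"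
  obtains r q0 q1 L where "0 < r" "0 < q0" "0 \<le> q1" "0 \<le> L" "cball \<theta>star r \<subseteq> \<Theta>"
    and "\<And>\<theta>. \<theta> \<in> cball \<theta>star r \<Longrightarrow> q0 \<le> \<pi> \<theta> \<and> \<pi> \<theta> \<le> q1"
    and "\<And>\<theta> \<theta>'. \<theta> \<in> cball \<theta>star r \<Longrightarrow> \<theta>' \<in> cball \<theta>star r \<Longrightarrow> \<bar>\<pi> \<theta> - \<pi> \<theta>'\<bar> \<le> L * norm (\<theta> - \<theta>')"
proof -
  obtain r1 where r1: "0 < r1" "\<And>\<theta>. \<theta> \<in> ball \<theta>star r1 \<Longrightarrow> 0 < \<pi> \<theta>" "twice_cont_diff_on (ball \<theta>star r1) \<pi>"
    using assms(1) unfolding assm_A1'_def by blast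
  obtain r2 where r2: "0 < r2" "ball \<theta>star r2 \<subseteq> \<Theta>"
    using assms(2,3) openE by blast
  obtain grad hess where
    d1: "\<And>\<theta>. \<theta> \<in> ball \<theta>star r1 \<Longrightarrow> (\<pi> has_derivative (\<lambda>h. grad \<theta> \<bullet> h)) (at \<theta>)"
    and d2: "\<And>\<theta>. \<theta> \<in> ball \<theta>star r1 \<Longrightarrow> (grad has_derivative (\<lambda>h. hess \<theta> *v h)) (at \<theta>)"
    using r1(3) unfolding twice_cont_diff_on_def by blast
  define r where "r = min r1 r2 / 2"
  have r: "0 < r" "r < r1" "r < r2" using r1(1) r2(1) by (auto simp: r_def min_def)
  let ?S = "cball \<theta>star r"
  have S: "?S \<subseteq> ball \<theta>star r1" "?S \<subseteq> \<Theta>" using r r2(2) by (auto simp: subset_iff)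
  have c1: "continuous_on ?S \<pi>"
    using S(1) d1 by (intro continuous_at_imp_continuous_on) (meson has_derivative_continuous subsetD)
  have c2: "continuous_on ?S grad"
    using S(1) d2 by (intro continuous_at_imp_continuous_on) (meson has_derivative_continuous subsetD)
  have ne: "?S \<noteq> {}" using r(1) by simp
  obtain a where a: "a \<in> ?S" "\<And>y. y \<in> ?S \<Longrightarrow> \<pi> a \<le> \<pi> y"
    using continuous_attains_inf[OF compact_cball ne c1] by blast
  obtain b where b: "b \<in> ?S" "\<And>y. y \<in> ?S \<Longrightarrow> \<pi> y \<le> \<pi> b"
    using continuous_attains_sup[OF compact_cball ne c1] by blast
  have "continuous_on ?S (\<lambda>y. norm (grad y))" using c2 by (intro continuous_intros)
  then obtain e where e: "e \<in> ?S" "\<And>y. y \<in> ?S \<Longrightarrow> norm (grad y) \<le> norm (grad e)"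
    using continuous_attains_sup[OF compact_cball ne] by blast
  have lip: "\<bar>\<pi> x - \<pi> y\<bar> \<le> norm (grad e) * norm (x - y)" if "x \<in> ?S" "y \<in> ?S" for x y
  proof -
    have "norm (\<pi> x - \<pi> y) \<le> norm (grad e) * norm (x - y)"
    proof (rule differentiable_bound[of ?S \<pi> "\<lambda>\<theta> h. grad \<theta> \<bullet> h"])
      fix z assume z: "z \<in> ?S"
      show "(\<pi> has_derivative (\<lambda>h. grad z \<bullet> h)) (at z within ?S)"
        using z S(1) d1 has_derivative_at_withinI by blast
      show "onorm (\<lambda>h. grad z \<bullet> h) \<le> norm (grad e)"
      proof (rule onorm_le)
        fix h
        have "norm (grad z \<bullet> h) \<le> norm (grad z) * norm h" by (simp add: Cauchy_Schwarz_ineq2)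
        also have "\<dots> \<le> norm (grad e) * norm h" using e(2)[OF z] by (rule mult_right_mono) simp
        finally show "norm (grad z \<bullet> h) \<le> norm (grad e) * norm h" .
      qed
    qed (use that in auto)
    then show ?thesis by simp
  qed
  have "0 < \<pi> a" "0 < \<pi> b" using r1(2) S(1) a(1) b(1) by blast+
  then show ?thesis
    using that[of r "\<pi> a" "\<pi> b" "norm (grad e)"] r(1) a b S(2) lip by auto
qed

lemma cubic_form_scaleR: "cubic_form S (k *\<^sub>R h) = k ^ 3 * cubic_form S h"
  unfolding cubic_form_def sum_distrib_left
  by (intro sum.cong refl) (simp add: power3_eq_cube mult_ac)

lemma quadratic_form_scaleR: "(k *\<^sub>R h) \<bullet> ((H :: real ^ 'p ^ 'p) *v (k *\<^sub>R h)) = k\<^sup>2 * (h \<bullet> (H *v h))"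
  by (simp add: matrix_vector_mult_scaleR power2_eq_square)

lemma log_likelihood_pos: "0 < likelihood f \<Theta> n x \<theta> \<Longrightarrow> log_likelihood f \<Theta> n x \<theta> = ereal (ln (likelihood f \<Theta> n x \<theta>))"
  and log_likelihood_not_pos: "\<not> 0 < likelihood f \<Theta> n x \<theta> \<Longrightarrow> log_likelihood f \<Theta> n x \<theta> = - \<infinity>"
  by (auto simp: log_likelihood_def)

text \<open>Substituting \<open>h = sqrt (\<alpha> n * real n) *\<^sub>R t\<close> removes \<open>\<alpha> n\<close> from the expansion: it becomes a statement on
  the average log-likelihood in the original coordinate \<open>t\<close>, which can then be used with any other
  learning rate. The bound also yields positivity of the likelihood, since a vanishing likelihood
  would make the remainder infinite.\<close>

lemma R_tilde_expansion:
  fixes \<alpha> :: "nat \<Rightarrow> real" and H :: "nat \<Rightarrow> 'd sample \<Rightarrow> real ^ 'p ^ 'p" and M :: real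
  assumes sup: "\<not> (SUP h \<in> {h. norm h / sqrt (\<alpha> n * real n) \<le> \<delta>}.
                \<bar>R_tilde f \<Theta> \<theta>hat H S \<alpha> n x h\<bar> - ereal (M / (\<alpha> n * real n) * norm h ^ 4)) > 0"
    and \<alpha>: "0 < \<alpha> n" and n: "1 \<le> n" and \<delta>: "0 < \<delta>" and t: "norm t \<le> \<delta>"
  shows "0 < likelihood f \<Theta> n x (\<theta>hat n x)" "0 < likelihood f \<Theta> n x (\<theta>hat n x + t)"
    "\<bar>(ln (likelihood f \<Theta> n x (\<theta>hat n x + t)) - ln (likelihood f \<Theta> n x (\<theta>hat n x))) / real n
        + t \<bullet> (H n x *v t) / 2 - cubic_form (S n x) t / 6\<bar> \<le> M * norm t ^ 4"
proof -
  let ?L = "likelihood f \<Theta> n x" and ?m = "\<theta>hat n x"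
  define N where "N = \<alpha> n * real n"
  define s where "s = sqrt N"
  have N: "0 < N" using \<alpha> n by (simp add: N_def)
  then have s: "0 < s" "s\<^sup>2 = N" by (auto simp: s_def)
  have bound: "\<bar>R_tilde f \<Theta> \<theta>hat H S \<alpha> n x (s *\<^sub>R t)\<bar> \<le> ereal (M / N * norm (s *\<^sub>R t) ^ 4)"
    if "norm t \<le> \<delta>" for t
  proof -
    have "s *\<^sub>R t \<in> {h. norm h / sqrt (\<alpha> n * real n) \<le> \<delta>}"
      using that s by (simp flip: N_def s_def)
    then have "\<bar>R_tilde f \<Theta> \<theta>hat H S \<alpha> n x (s *\<^sub>R t)\<bar> - ereal (M / (\<alpha> n * real n) * norm (s *\<^sub>R t) ^ 4)
        \<le> (SUP h \<in> {h. norm h / sqrt (\<alpha> n * real n) \<le> \<delta>}.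
                \<bar>R_tilde f \<Theta> \<theta>hat H S \<alpha> n x h\<bar> - ereal (M / (\<alpha> n * real n) * norm h ^ 4))"
      by (rule SUP_upper)
    also have "\<dots> \<le> 0" using sup by (simp add: not_less)
    finally show ?thesis unfolding N_def[symmetric]
      by (cases "\<bar>R_tilde f \<Theta> \<theta>hat H S \<alpha> n x (s *\<^sub>R t)\<bar>") auto
  qed
  have R: "R_tilde f \<Theta> \<theta>hat H S \<alpha> n x (s *\<^sub>R t) = ereal (\<alpha> n) * (log_likelihood f \<Theta> n x (?m + t) - log_likelihood f \<Theta> n x ?m)
       + ereal (1 / 2 * (N * (t \<bullet> (H n x *v t)))) - ereal (1 / (6 * s) * (s ^ 3 * cubic_form (S n x) t))" for t
  proof -
    have "s *\<^sub>R t /\<^sub>R s = t" using s(1) by simp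
    then show ?thesis
      unfolding R_tilde_def N_def[symmetric] s_def[symmetric] cubic_form_scaleR quadratic_form_scaleR s(2)
      by simp
  qed
  show pm: "0 < ?L ?m"
  proof (rule ccontr)
    assume "\<not> 0 < ?L ?m"
    then have "R_tilde f \<Theta> \<theta>hat H S \<alpha> n x (s *\<^sub>R 0) = \<infinity>"
      unfolding R using \<alpha> by (simp add: log_likelihood_not_pos)
    then show False using bound[of 0] \<delta> by simp
  qed
  show pt: "0 < ?L (?m + t)"
  proof (rule ccontr)
    assume "\<not> 0 < ?L (?m + t)"
    then have "R_tilde f \<Theta> \<theta>hat H S \<alpha> n x (s *\<^sub>R t) = - \<infinity>"
      unfolding R using \<alpha> pm by (simp add: log_likelihood_not_pos log_likelihood_pos)
    then show False using bound[OF t] by simp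
  qed
  define y where "y = (ln (?L (?m + t)) - ln (?L ?m)) / real n
        + t \<bullet> (H n x *v t) / 2 - cubic_form (S n x) t / 6"
  have "s ^ 3 = s * N" by (simp add: s(2)[symmetric] power3_eq_cube power2_eq_square)
  then have "R_tilde f \<Theta> \<theta>hat H S \<alpha> n x (s *\<^sub>R t) = ereal (N * y)"
    unfolding R y_def using pm pt s(1) n by (simp add: log_likelihood_pos N_def field_simps)
  moreover have "norm (s *\<^sub>R t) ^ 4 = N\<^sup>2 * norm t ^ 4"
    using s by (simp add: power_mult_distrib flip: s(2))
  ultimately have "N * \<bar>y\<bar> \<le> N * (M * norm t ^ 4)"
    using bound[OF t] N by (simp add: abs_mult power2_eq_square mult_ac)
  then show "\<bar>y\<bar> \<le> M * norm t ^ 4" using N by simp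
qed

text \<open>By homogeneity an upper bound on the sphere of radius \<open>\<delta>\<close> extends to all \<open>t\<close>, and since the form is
  odd the bound at \<open>- t\<close> is a lower bound at \<open>t\<close>.\<close>

lemma cubic_form_bound:
  assumes \<delta>: "0 < \<delta>" and le: "\<And>t. norm t \<le> \<delta> \<Longrightarrow> cubic_form S t \<le> a * (norm t)\<^sup>2 + b * norm t ^ 4"
  shows "\<bar>cubic_form S t\<bar> \<le> (a / \<delta> + b * \<delta>) * norm t ^ 3"
proof -
  have up: "cubic_form S t \<le> (a / \<delta> + b * \<delta>) * norm t ^ 3" for t
  proof (cases "t = 0")
    case True
    then show ?thesis using cubic_form_scaleR[of S 0 0] by simp
  next
    case False
    define k where "k = norm t / \<delta>"
    define e where "e = (1 / k) *\<^sub>R t"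
    have k: "0 < k" using False \<delta> by (simp add: k_def)
    have ne: "norm e = \<delta>" using False \<delta> by (simp add: e_def k_def)
    have "cubic_form S t = k ^ 3 * cubic_form S e"
      using k by (simp flip: cubic_form_scaleR add: e_def)
    also have "\<dots> \<le> k ^ 3 * (a * \<delta>\<^sup>2 + b * \<delta> ^ 4)"
      using le[of e] k ne by (intro mult_left_mono) auto
    also have "\<dots> = (a / \<delta> + b * \<delta>) * norm t ^ 3"
      using \<delta> by (simp add: k_def field_simps power2_eq_square power3_eq_cube power4_eq_xxxx)
    finally show ?thesis .
  qed
  show ?thesis using up[of t] up[of "- t"] cubic_form_scaleR[of S "-1" t] by (simp add: abs_le_iff)
qed

lemma likelihood_far:
  assumes sup: "\<not> (SUP \<theta> \<in> - ball m \<delta>.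
             ereal (1 / real n) * log_likelihood f \<Theta> n x \<theta>
             - ereal (1 / real n) * log_likelihood f \<Theta> n x m) > - ereal c"
    and n: "1 \<le> n" and pos: "0 < likelihood f \<Theta> n x m" and far: "\<delta> \<le> norm (\<theta> - m)"
    and nonneg: "0 \<le> likelihood f \<Theta> n x \<theta>"
  shows "likelihood f \<Theta> n x \<theta> \<le> exp (- c * real n) * likelihood f \<Theta> n x m"
proof (cases "0 < likelihood f \<Theta> n x \<theta>")
  case True
  have "\<theta> \<in> - ball m \<delta>" using far by (simp add: dist_norm norm_minus_commute)
  then have "ereal (1 / real n) * log_likelihood f \<Theta> n x \<theta> - ereal (1 / real n) * log_likelihood f \<Theta> n x m
     \<le> (SUP \<theta> \<in> - ball m \<delta>. ereal (1 / real n) * log_likelihood f \<Theta> n x \<theta>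
             - ereal (1 / real n) * log_likelihood f \<Theta> n x m)"
    by (rule SUP_upper)
  also have "\<dots> \<le> - ereal c" using sup by (simp add: not_less)
  finally have "ln (likelihood f \<Theta> n x \<theta>) / n - ln (likelihood f \<Theta> n x m) / n \<le> - c"
    using True pos by (simp add: log_likelihood_pos)
  then have "ln (likelihood f \<Theta> n x \<theta>) \<le> - c * n + ln (likelihood f \<Theta> n x m)"
    using n by (simp add: field_simps)
  then have "exp (ln (likelihood f \<Theta> n x \<theta>)) \<le> exp (- c * n + ln (likelihood f \<Theta> n x m))"
    by simp
  then show ?thesis using True pos by (simp only: exp_add exp_ln)
next
  case False
  then have "likelihood f \<Theta> n x \<theta> = 0" using nonneg by simp
  then show ?thesis using pos by simp
qed

text \<open>Dividing the likelihood by its value at \<open>m\<close> cancels in the posterior density and produces a weight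
  that equals 1 at \<open>m\<close>, as needed for bounds that are uniform in the data.\<close>

lemma posterior_mean_minus:
  fixes f :: "nat \<Rightarrow> ('d::finite) sample \<Rightarrow> real ^ 'p \<Rightarrow> real" and \<pi> :: "real ^ 'p \<Rightarrow> real"
    and m :: "real ^ 'p" and a :: real
    and \<Theta> n x
  defines "w \<equiv> \<lambda>\<theta>. (likelihood f \<Theta> n x \<theta> / likelihood f \<Theta> n x m) powr a"
    and "q \<equiv> \<lambda>\<theta>. indicator \<Theta> \<theta> * \<pi> \<theta>"
  assumes pos: "0 < likelihood f \<Theta> n x m" and nonneg: "\<And>\<theta>. 0 \<le> likelihood f \<Theta> n x \<theta>"
    and int0: "integrable lborel (\<lambda>\<theta>. w \<theta> * q \<theta>)"
    and int1: "integrable lborel (\<lambda>\<theta>. (w \<theta> * q \<theta>) *\<^sub>R (\<theta> - m))"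
    and Z: "0 < (\<integral>\<theta>. w \<theta> * q \<theta> \<partial>lborel)"
  shows "posterior_mean f \<Theta> \<pi> n a x - m
     = (\<integral>\<theta>. (w \<theta> * q \<theta>) *\<^sub>R (\<theta> - m) \<partial>lborel) /\<^sub>R (\<integral>\<theta>. w \<theta> * q \<theta> \<partial>lborel)"
proof -
  define k where "k = likelihood f \<Theta> n x m powr a"
  define I where "I = (\<integral>\<theta>. w \<theta> * q \<theta> \<partial>lborel)"
  have k: "0 < k" using pos by (simp add: k_def)
  have I: "0 < I" using Z by (simp add: I_def)
  have "likelihood f \<Theta> n x \<theta> powr a = k * w \<theta>" for \<theta>
    using nonneg[of \<theta>] pos by (simp add: w_def k_def powr_divide)
  then have num: "likelihood f \<Theta> n x \<theta> powr a * \<pi> \<theta> = k * (w \<theta> * q \<theta>)" for \<theta>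
    using likelihood_powr_prior[of f \<Theta> n x \<theta> a \<pi>] by (simp add: q_def)
  have dens: "posterior_density f \<Theta> \<pi> n a x \<theta> = inverse I * (w \<theta> * q \<theta>)" for \<theta>
    unfolding posterior_density_def num using k by (simp add: I_def divide_inverse)
  have split: "posterior_density f \<Theta> \<pi> n a x \<theta> *\<^sub>R \<theta>
      = inverse I *\<^sub>R ((w \<theta> * q \<theta>) *\<^sub>R (\<theta> - m)) + inverse I *\<^sub>R ((w \<theta> * q \<theta>) *\<^sub>R m)" for \<theta>
    unfolding dens by (simp add: algebra_simps)
  have "posterior_mean f \<Theta> \<pi> n a x
      = (\<integral>\<theta>. inverse I *\<^sub>R ((w \<theta> * q \<theta>) *\<^sub>R (\<theta> - m)) \<partial>lborel) + (\<integral>\<theta>. inverse I *\<^sub>R ((w \<theta> * q \<theta>) *\<^sub>R m) \<partial>lborel)"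
    unfolding posterior_mean_def split
    by (intro Bochner_Integration.integral_add integrable_scaleR_right integrable_scaleR_left int0 int1)
  also have "(\<integral>\<theta>. inverse I *\<^sub>R ((w \<theta> * q \<theta>) *\<^sub>R (\<theta> - m)) \<partial>lborel)
      = inverse I *\<^sub>R (\<integral>\<theta>. (w \<theta> * q \<theta>) *\<^sub>R (\<theta> - m) \<partial>lborel)"
    by (rule integral_scaleR_right)
  also have "(\<integral>\<theta>. inverse I *\<^sub>R ((w \<theta> * q \<theta>) *\<^sub>R m) \<partial>lborel) = inverse I *\<^sub>R (I *\<^sub>R m)"
    using int0 by (simp add: I_def del: scaleR_scaleR)
  also have "inverse I *\<^sub>R (I *\<^sub>R m) = m" using I by simp
  finally show ?thesis by (simp add: I_def)
qed

text \<open>Here \<open>g\<close> is the average log-likelihood ratio, which is nonpositive when the ratio is taken at the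
  maximiser. Together with the fourth-order expansion and the upper bound on the quadratic form this
  bounds the cubic form above on a ball of fixed radius, hence everywhere. The cubic term can therefore be
  moved into the error.\<close>

lemma log_likelihood_cubic_remainder:
  fixes H :: "real ^ 'p ^ 'p" and g :: "real ^ 'p \<Rightarrow> real"
  assumes \<delta>: "0 < \<delta>" and t: "norm t \<le> \<delta>"
    and quad: "\<And>h. h \<bullet> (H *v h) \<le> u * (norm h)\<^sup>2"
    and expand: "\<And>t. norm t \<le> \<delta> \<Longrightarrow> \<bar>g t + t \<bullet> (H *v t) / 2 - cubic_form S t / 6\<bar> \<le> M * norm t ^ 4"
    and le0: "\<And>t. norm t \<le> \<delta> \<Longrightarrow> g t \<le> 0"
  shows "\<bar>g t + t \<bullet> (H *v t) / 2\<bar> \<le> (\<bar>u\<bar> / (2 * \<delta>) + 2 * \<bar>M\<bar> * \<delta>) * norm t ^ 3"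
proof -
  have M: "M * norm t ^ 4 \<le> \<bar>M\<bar> * norm t ^ 4" for t :: "real ^ 'p" by (intro mult_right_mono) auto
  have u: "u * (norm t)\<^sup>2 \<le> \<bar>u\<bar> * (norm t)\<^sup>2" for t :: "real ^ 'p" by (intro mult_right_mono) auto
  have "cubic_form S t \<le> 3 * \<bar>u\<bar> * (norm t)\<^sup>2 + 6 * \<bar>M\<bar> * norm t ^ 4" if "norm t \<le> \<delta>" for t
    using expand[OF that] le0[OF that] quad[of t] M[of t] u[of t] by (simp add: abs_le_iff)
  from cubic_form_bound[OF \<delta> this, of t]
  have S: "\<bar>cubic_form S t\<bar> \<le> (3 * \<bar>u\<bar> / \<delta> + 6 * \<bar>M\<bar> * \<delta>) * norm t ^ 3" by simp
  have "\<bar>g t + t \<bullet> (H *v t) / 2\<bar> \<le> M * norm t ^ 4 + \<bar>cubic_form S t\<bar> / 6"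
    using expand[OF t] by (simp add: abs_if split: if_splits)
  also have "\<dots> \<le> \<bar>M\<bar> * \<delta> * norm t ^ 3 + (3 * \<bar>u\<bar> / \<delta> + 6 * \<bar>M\<bar> * \<delta>) * norm t ^ 3 / 6"
  proof (intro add_mono divide_right_mono S)
    have "norm t * norm t ^ 3 \<le> \<delta> * norm t ^ 3" using t by (intro mult_right_mono) auto
    then have "\<bar>M\<bar> * norm t ^ 4 \<le> \<bar>M\<bar> * (\<delta> * norm t ^ 3)"
      by (intro mult_left_mono) (auto simp: power4_eq_xxxx power3_eq_cube)
    then show "M * norm t ^ 4 \<le> \<bar>M\<bar> * \<delta> * norm t ^ 3" using M[of t] by (simp add: mult.assoc)
  qed simp
  also have "\<dots> = (\<bar>u\<bar> / (2 * \<delta>) + 2 * \<bar>M\<bar> * \<delta>) * norm t ^ 3"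
    using \<delta> by (simp add: field_simps)
  finally show ?thesis .
qed

text \<open>The powers of the likelihood ratio satisfy the hypotheses of the Laplace bound with effective sample
  size \<open>a * real n\<close>. The constants depend neither on \<open>a\<close> nor on \<open>n\<close>.\<close>

lemma laplace_setting_posterior:
  fixes H :: "real ^ 'p ^ 'p" and m :: "real ^ 'p"
  assumes model: "statistical_model \<X> \<nu> f0 f \<Theta>" and prior: "is_prior \<Theta> \<pi>"
    and n: "1 \<le> n" and x: "x \<in> space (sample_measure \<nu> n)"
    and a: "0 < a" and N: "1 \<le> a * real n"
    and quad: "\<And>h. l * (norm h)\<^sup>2 \<le> h \<bullet> (H *v h) \<and> h \<bullet> (H *v h) \<le> u * (norm h)\<^sup>2"
    and pos: "0 < likelihood f \<Theta> n x m"
    and near: "\<And>t. norm t < \<delta> \<Longrightarrow> 0 < likelihood f \<Theta> n x (m + t) \<and>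
      \<bar>(ln (likelihood f \<Theta> n x (m + t)) - ln (likelihood f \<Theta> n x m)) / real n + t \<bullet> (H *v t) / 2\<bar> \<le> C * norm t ^ 3"
    and far: "\<And>\<theta>. \<delta> \<le> norm (\<theta> - m) \<Longrightarrow> likelihood f \<Theta> n x \<theta> \<le> exp (- c * real n) * likelihood f \<Theta> n x m"
    and bounds: "\<And>\<theta>. norm (\<theta> - m) < \<delta> \<Longrightarrow> \<theta> \<in> \<Theta> \<and> q0 \<le> \<pi> \<theta> \<and> \<pi> \<theta> \<le> q1 \<and> \<bar>\<pi> \<theta> - \<pi> m\<bar> \<le> L * norm (\<theta> - m)"
    and \<delta>: "0 < \<delta>"
    and mean: "integrable lborel (\<lambda>\<theta>. (indicator \<Theta> \<theta> * \<pi> \<theta>) *\<^sub>R \<theta>)"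
    and D: "(\<integral>\<theta>. norm ((indicator \<Theta> \<theta> * \<pi> \<theta>) *\<^sub>R \<theta>) \<partial>lborel) + norm m \<le> D"
  shows "laplace_setting l u C \<delta> c q0 q1 L D (a * real n) m (\<lambda>h. h \<bullet> (H *v h))
     (\<lambda>\<theta>. (likelihood f \<Theta> n x \<theta> / likelihood f \<Theta> n x m) powr a) (\<lambda>\<theta>. indicator \<Theta> \<theta> * \<pi> \<theta>)"
proof -
  define q where "q \<theta> = indicator \<Theta> \<theta> * \<pi> \<theta>" for \<theta>
  note L_nonneg = likelihood_nonneg[OF model n x]
  have [measurable]: "q \<in> borel_measurable borel" and q0: "\<And>\<theta>. 0 \<le> q \<theta>" and q1: "(\<integral>\<^sup>+ \<theta>. ennreal (q \<theta>) \<partial>lborel) = 1"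
    using prior by (auto simp: is_prior_def is_density_def q_def[abs_def])
  have qint: "integrable lborel q" using q0 q1 by (intro integrableI_nonneg) auto
  have q_total: "(\<integral>\<theta>. q \<theta> \<partial>lborel) = 1"
    using q0 q1 by (subst integral_eq_nn_integral) auto
  have "(\<lambda>(x, \<theta>). likelihood f \<Theta> n x \<theta>) \<in> borel_measurable (sample_measure \<nu> n \<Otimes>\<^sub>M borel)"
    using model n by (simp add: statistical_model_def)
  from measurable_compose_Pair1[OF x this]
  have [measurable]: "likelihood f \<Theta> n x \<in> borel_measurable borel" by simp
  have qmean: "integrable lborel (\<lambda>\<theta>. norm (q \<theta> *\<^sub>R \<theta>))"
    using mean unfolding q_def by (rule integrable_norm)
  have qdom: "integrable lborel (\<lambda>\<theta>. norm (q \<theta> *\<^sub>R \<theta>) + norm m * q \<theta>)"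
    by (intro Bochner_Integration.integrable_add qmean integrable_mult_right qint)
  have tri: "norm (\<theta> - m) * q \<theta> \<le> norm (q \<theta> *\<^sub>R \<theta>) + norm m * q \<theta>" for \<theta>
    using mult_right_mono[OF norm_triangle_ineq4[of \<theta> m] q0[of \<theta>]] q0[of \<theta>]
    by (simp add: algebra_simps)
  have q1int: "integrable lborel (\<lambda>\<theta>. norm (\<theta> - m) * q \<theta>)"
  proof (rule Bochner_Integration.integrable_bound[OF qdom])
    show "AE \<theta> in lborel. norm (norm (\<theta> - m) * q \<theta>) \<le> norm (norm (q \<theta> *\<^sub>R \<theta>) + norm m * q \<theta>)"
      using tri q0 by (intro AE_I2) (simp add: abs_of_nonneg)
  qed measurable
  have "(\<integral>\<theta>. norm (\<theta> - m) * q \<theta> \<partial>lborel) \<le> (\<integral>\<theta>. norm (q \<theta> *\<^sub>R \<theta>) + norm m * q \<theta> \<partial>lborel)"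
    by (intro integral_mono q1int qdom tri)
  also have "\<dots> = (\<integral>\<theta>. norm (q \<theta> *\<^sub>R \<theta>) \<partial>lborel) + norm m"
    using qmean qint q_total by (subst Bochner_Integration.integral_add) auto
  also have "\<dots> \<le> D" using D by (simp only: q_def)
  finally have q1D: "(\<integral>\<theta>. norm (\<theta> - m) * q \<theta> \<partial>lborel) \<le> D" .
  have nearw: "\<exists>r. \<bar>r\<bar> \<le> C * norm (\<theta> - m) ^ 3 \<and>
      (likelihood f \<Theta> n x \<theta> / likelihood f \<Theta> n x m) powr a
        = exp (a * real n * (r - (\<theta> - m) \<bullet> (H *v (\<theta> - m)) / 2))"
    if "norm (\<theta> - m) < \<delta>" for \<theta>
  proof -
    define d where "d = ln (likelihood f \<Theta> n x \<theta>) - ln (likelihood f \<Theta> n x m)"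
    define r where "r = d / real n + (\<theta> - m) \<bullet> (H *v (\<theta> - m)) / 2"
    have p: "0 < likelihood f \<Theta> n x \<theta>" and r: "\<bar>r\<bar> \<le> C * norm (\<theta> - m) ^ 3"
      using near[OF that] by (auto simp: r_def d_def)
    have "(likelihood f \<Theta> n x \<theta> / likelihood f \<Theta> n x m) powr a = exp (a * d)"
      using p pos by (simp add: powr_def ln_div d_def)
    also have "a * d = a * real n * (r - (\<theta> - m) \<bullet> (H *v (\<theta> - m)) / 2)"
      using n by (simp add: r_def)
    finally show ?thesis using r by blast
  qed
  have farw: "(likelihood f \<Theta> n x \<theta> / likelihood f \<Theta> n x m) powr a \<le> exp (- c * (a * real n))"
    if "\<delta> \<le> norm (\<theta> - m)" for \<theta>
  proof -
    have "likelihood f \<Theta> n x \<theta> / likelihood f \<Theta> n x m \<le> exp (- c * real n)"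
      using far[OF that] pos by (simp add: pos_divide_le_eq)
    then have "(likelihood f \<Theta> n x \<theta> / likelihood f \<Theta> n x m) powr a \<le> exp (- c * real n) powr a"
      using L_nonneg[of \<theta>] pos a by (intro powr_mono2) auto
    also have "\<dots> = exp (- c * (a * real n))" by (simp add: powr_def mult_ac)
    finally show ?thesis .
  qed
  have qb: "q0 \<le> q \<theta> \<and> q \<theta> \<le> q1 \<and> \<bar>q \<theta> - q m\<bar> \<le> L * norm (\<theta> - m)" if "norm (\<theta> - m) < \<delta>" for \<theta>
    using bounds[OF that] bounds[of m] \<delta> by (simp add: q_def)
  have mQ: "(\<lambda>h. h \<bullet> (H *v h)) \<in> borel_measurable borel"
    by (intro borel_measurable_continuous_onI continuous_intros matrix_vector_mult_linear_continuous_on)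
  have mw: "(\<lambda>\<theta>. (likelihood f \<Theta> n x \<theta> / likelihood f \<Theta> n x m) powr a) \<in> borel_measurable borel"
    by measurable
  show ?thesis
    unfolding laplace_setting_def q_def[symmetric]
    using quad qb
    by (intro conjI allI impI N mQ mw quadratic_form_scaleR nearw farw powr_ge_zero q0 qint q1int q1D) auto
qed

section \<open>Asymptotic equivalence of the posterior mean and the MLE\<close>

text \<open>The constants of the Laplace bound are obtained in a fixed order: \<open>l\<close>, \<open>u\<close> from the spectrum of
  $H_n$, then the radius of the expansion, then the radius on which the prior is controlled, then the
  smaller radius \<open>\<delta>'\<close>, and last the rate \<open>c\<close> at which the likelihood decays outside that radius. Each of
  the six assumptions on the data may fail with probability \<open>\<epsilon> / 6\<close>.\<close>

lemma posterior_mean_near_MLE: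
  fixes \<nu> :: "(real ^ 'd) measure" and f :: "nat \<Rightarrow> 'd sample \<Rightarrow> real ^ 'p \<Rightarrow> real"
    and P :: "nat \<Rightarrow> 'd sample measure" and f0
  defines "P \<equiv> true_law \<nu> f0"
  assumes model: "statistical_model \<X> \<nu> f0 f \<Theta>" and prior: "is_prior \<Theta> \<pi>"
    and A0: "assm_A0 P f \<Theta> \<theta>hat \<theta>star V" and A1': "assm_A1' \<Theta> \<pi> \<theta>star"
    and A2': "assm_A2' P f \<Theta> \<theta>hat \<alpha>" and A3': "assm_A3' P f \<Theta> \<theta>hat"
    and \<alpha>: "vanishing_slower (\<lambda>n. 1 / real n) \<alpha>"
    and ratio: "tends_in_prob P (\<lambda>n x. \<alpha>hat n x / \<alpha> n) 1"
    and \<epsilon>: "0 < \<epsilon>"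
  shows "\<exists>K. eventually_likely P \<epsilon> (\<lambda>n x.
    norm (posterior_mean f \<Theta> \<pi> n (\<alpha>hat n x) x - \<theta>hat n x) \<le> K / (\<alpha> n * real n))"
proof -
  define e where "e = \<epsilon> / 6"
  have e: "0 < e" using \<epsilon> by (simp add: e_def)
  obtain H S and M :: real where tight: "spectrum_tight P H"
    and exp4: "\<And>\<epsilon>. 0 < \<epsilon> \<Longrightarrow> \<exists>\<delta>>0. \<forall>\<^sub>F n in sequentially.
           outer_prob (P n) (\<lambda>x.
             (SUP h \<in> {h. norm h / sqrt (\<alpha> n * real n) \<le> \<delta>}.
                \<bar>R_tilde f \<Theta> \<theta>hat H S \<alpha> n x h\<bar> - ereal (M / (\<alpha> n * real n) * norm h ^ 4)) > 0)
           < ennreal \<epsilon>"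
    using A2' unfolding assm_A2'_def by blast
  obtain l u where l: "0 < l"
    and g_spec: "eventually_likely P e (\<lambda>n x. \<forall>h. l * (norm h)\<^sup>2 \<le> h \<bullet> (H n x *v h) \<and> h \<bullet> (H n x *v h) \<le> u * (norm h)\<^sup>2)"
    using tight e unfolding spectrum_tight_def by (blast intro: eventually_likely_outer_prob)
  obtain \<delta> where \<delta>: "0 < \<delta>"
    and "\<forall>\<^sub>F n in sequentially. outer_prob (P n) (\<lambda>x. (SUP h \<in> {h. norm h / sqrt (\<alpha> n * real n) \<le> \<delta>}.
                \<bar>R_tilde f \<Theta> \<theta>hat H S \<alpha> n x h\<bar> - ereal (M / (\<alpha> n * real n) * norm h ^ 4)) > 0) < ennreal e"
    using exp4[OF e] by blast
  note g_exp = eventually_likely_not[OF this(2)]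
  have \<Theta>: "open \<Theta>" "\<theta>star \<in> \<Theta>" using A0 by (auto simp: assm_A0_def)
  obtain r q0 q1 L where r: "0 < r" and q0: "0 < q0" and q1: "0 \<le> q1" and L: "0 \<le> L" and r\<Theta>: "cball \<theta>star r \<subseteq> \<Theta>"
    and qb: "\<And>\<theta>. \<theta> \<in> cball \<theta>star r \<Longrightarrow> q0 \<le> \<pi> \<theta> \<and> \<pi> \<theta> \<le> q1"
    and qlip: "\<And>\<theta> \<theta>'. \<theta> \<in> cball \<theta>star r \<Longrightarrow> \<theta>' \<in> cball \<theta>star r \<Longrightarrow> \<bar>\<pi> \<theta> - \<pi> \<theta>'\<bar> \<le> L * norm (\<theta> - \<theta>')"
    using prior_bounds_near[OF A1' \<Theta>] by metis
  \<comment> \<open>absolute values because \<open>u\<close> and \<open>M\<close> are not known to be nonnegative at this point\<close>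
  define C where "C = \<bar>u\<bar> / (2 * \<delta>) + 2 * \<bar>M\<bar> * \<delta>"
  have C: "0 \<le> C" using \<delta> by (simp add: C_def)
  \<comment> \<open>inside the expansion radius; small enough that the ball around the MLE stays where the prior is controlled and that the cubic error is at most half of the quadratic term\<close>
  define \<delta>' where "\<delta>' = min \<delta> (min (r / 2) (l / (4 * (C + 1))))"
  have "0 < l / (4 * (C + 1))" using l C by simp
  then have \<delta>': "0 < \<delta>'" "\<delta>' \<le> \<delta>" "\<delta>' \<le> r / 2" "\<delta>' \<le> l / (4 * (C + 1))"
    unfolding \<delta>'_def using \<delta> r by linarith+
  have C\<delta>: "C * \<delta>' \<le> l / 4"
  proof -
    have "C * \<delta>' \<le> (C + 1) * \<delta>'" using \<delta>'(1) by (intro mult_right_mono) auto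
    also have "\<dots> \<le> (C + 1) * (l / (4 * (C + 1)))" using \<delta>'(4) C by (intro mult_left_mono) auto
    also have "\<dots> = l / 4" using C by (simp add: field_simps)
    finally show ?thesis .
  qed
  obtain c :: real where c: "0 < c"
    and "\<forall>\<^sub>F n in sequentially. outer_prob (P n) (\<lambda>x. (SUP \<theta> \<in> - ball (\<theta>hat n x) \<delta>'.
             ereal (1 / real n) * log_likelihood f \<Theta> n x \<theta>
             - ereal (1 / real n) * log_likelihood f \<Theta> n x (\<theta>hat n x)) > - ereal c) < ennreal e"
    using A3' e \<delta>'(1) unfolding assm_A3'_def by blast
  note g_far = eventually_likely_not[OF this(2)]
  have "(\<lambda>n. outer_prob (P n) (\<lambda>x. r / 2 < dist (\<theta>hat n x) \<theta>star)) \<longlonglongrightarrow> 0"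
    using A0 half_gt_zero[OF r] unfolding assm_A0_def tends_in_prob_def by blast
  then have g_cons: "eventually_likely P e (\<lambda>n x. \<not> r / 2 < dist (\<theta>hat n x) \<theta>star)"
    using e by (intro eventually_likely_outer_prob_tendsto) auto
  have "(\<lambda>n. outer_prob (P n) (\<lambda>x. 1 / 2 < dist (\<alpha>hat n x / \<alpha> n) 1)) \<longlonglongrightarrow> 0"
    using ratio unfolding tends_in_prob_def by (auto dest: spec[of _ "1 / 2"])
  then have g_ratio: "eventually_likely P e (\<lambda>n x. \<not> 1 / 2 < dist (\<alpha>hat n x / \<alpha> n) 1)"
    using e by (intro eventually_likely_outer_prob_tendsto) auto
  have g_mle: "eventually_likely P e (\<lambda>n x. is_MLE f \<Theta> n x (\<theta>hat n x))"
    using A0 e unfolding assm_A0_def by (intro eventually_likely_AE) (auto elim!: eventually_mono)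
  \<comment> \<open>\<open>norm \<theta>star + r\<close> bounds the norm of the MLE on the event of consistency\<close>
  define D where "D = (\<integral>\<theta>. norm ((indicator \<Theta> \<theta> * \<pi> \<theta>) *\<^sub>R \<theta>) \<partial>lborel) + (norm \<theta>star + r)"
  have D: "0 \<le> D" unfolding D_def using r by (intro add_nonneg_nonneg integral_nonneg_AE) auto
  have mean: "integrable lborel (\<lambda>\<theta>. (indicator \<Theta> \<theta> * \<pi> \<theta>) *\<^sub>R \<theta>)"
    using A1' by (simp add: assm_A1'_def)
  obtain K where K: "0 \<le> K"
    and laplace: "\<And>N (m :: real ^ 'p) Q w q. laplace_setting l u C \<delta>' c q0 q1 L D N m Q w q \<Longrightarrow>
           0 < (\<integral>x. w x * q x \<partial>lborel) \<and>
           norm (\<integral>x. (w x * q x) *\<^sub>R (x - m) \<partial>lborel) \<le> K / N * (\<integral>x. w x * q x \<partial>lborel)"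
    using laplace_mean_bound[OF l C \<delta>'(1) C\<delta> c q0 q1 L D] by blast
  have "(\<lambda>n. 1 / real n / \<alpha> n) \<longlonglongrightarrow> 0" using \<alpha> by (simp add: vanishing_slower_def)
  then have "\<forall>\<^sub>F n in sequentially. 1 / real n / \<alpha> n < 1 / 2" by (rule order_tendstoD) simp
  then have big: "\<forall>\<^sub>F n in sequentially. 1 \<le> n \<and> 0 < \<alpha> n \<and> 2 \<le> \<alpha> n * real n"
    using eventually_ge_at_top[of 1]
  proof eventually_elim
    case (elim n)
    then have "0 < \<alpha> n" using \<alpha> by (simp add: vanishing_slower_def)
    with elim show ?case by (simp add: field_simps)
  qed
  note likely = eventually_likely_conj[OF g_spec eventually_likely_conj[OF g_exp eventually_likely_conj[OF g_far
        eventually_likely_conj[OF g_cons eventually_likely_conj[OF g_ratio g_mle]]]]]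
  have "eventually_likely P (e + (e + (e + (e + (e + e))))) (\<lambda>n x.
    norm (posterior_mean f \<Theta> \<pi> n (\<alpha>hat n x) x - \<theta>hat n x) \<le> (2 * K) / (\<alpha> n * real n))"
  proof (rule eventually_likely_mono[OF likely big], elim conjE)
    fix n x
    assume n: "1 \<le> n" and \<alpha>n: "0 < \<alpha> n" and N: "2 \<le> \<alpha> n * real n" and "x \<in> space (P n)"
      and spec: "\<forall>h. l * (norm h)\<^sup>2 \<le> h \<bullet> (H n x *v h) \<and> h \<bullet> (H n x *v h) \<le> u * (norm h)\<^sup>2"
      and sup: "\<not> (SUP h \<in> {h. norm h / sqrt (\<alpha> n * real n) \<le> \<delta>}.
              \<bar>R_tilde f \<Theta> \<theta>hat H S \<alpha> n x h\<bar> - ereal (M / (\<alpha> n * real n) * norm h ^ 4)) > 0"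
      and far: "\<not> (SUP \<theta> \<in> - ball (\<theta>hat n x) \<delta>'.
           ereal (1 / real n) * log_likelihood f \<Theta> n x \<theta>
           - ereal (1 / real n) * log_likelihood f \<Theta> n x (\<theta>hat n x)) > - ereal c"
      and cons: "\<not> r / 2 < dist (\<theta>hat n x) \<theta>star" and rat: "\<not> 1 / 2 < dist (\<alpha>hat n x / \<alpha> n) 1"
      and mle: "is_MLE f \<Theta> n x (\<theta>hat n x)"
    let ?m = "\<theta>hat n x" and ?a = "\<alpha>hat n x" and ?L = "likelihood f \<Theta> n x"
    have x: "x \<in> space (sample_measure \<nu> n)"
      using \<open>x \<in> space (P n)\<close> by (simp add: P_def true_law_def)
    have a_half: "\<alpha> n / 2 \<le> ?a"
    proof -
      have "1 / 2 \<le> ?a / \<alpha> n" using rat unfolding dist_real_def by linarith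
      then show ?thesis using \<alpha>n by (simp add: field_simps)
    qed
    then have a: "0 < ?a" using \<alpha>n by linarith
    have "\<alpha> n / 2 * real n \<le> ?a * real n" using a_half by (intro mult_right_mono) auto
    then have aN: "\<alpha> n * real n / 2 \<le> ?a * real n" by simp
    note expand = R_tilde_expansion[where S = S and M = M and \<theta>hat = \<theta>hat and H = H, OF sup \<alpha>n n \<delta>]
    have pos: "0 < ?L ?m" using expand(1)[of 0] \<delta> by simp
    have max: "?L (?m + t) \<le> ?L ?m" if "norm t \<le> \<delta>" for t
      using expand(2)[OF that] pos mle
      by (auto simp: likelihood_def is_MLE_def is_arg_max_linorder split: if_splits)
    define g where "g t = (ln (?L (?m + t)) - ln (?L ?m)) / real n" for t
    have rem: "\<bar>g t + t \<bullet> (H n x *v t) / 2\<bar> \<le> C * norm t ^ 3" if "norm t \<le> \<delta>" for t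
      unfolding C_def
    proof (rule log_likelihood_cubic_remainder[OF \<delta> that])
      show "h \<bullet> (H n x *v h) \<le> u * (norm h)\<^sup>2" for h using spec by blast
      show "\<bar>g t + t \<bullet> (H n x *v t) / 2 - cubic_form (S n x) t / 6\<bar> \<le> M * norm t ^ 4" if "norm t \<le> \<delta>" for t
        using expand(3)[OF that] by (simp add: g_def)
      show "g t \<le> 0" if "norm t \<le> \<delta>" for t
      proof -
        have "ln (?L (?m + t)) \<le> ln (?L ?m)" using max[OF that] expand(2)[OF that] pos by simp
        then show ?thesis by (simp add: g_def divide_nonpos_nonneg)
      qed
    qed
    have in_cball: "\<theta> \<in> cball \<theta>star r" if "norm (\<theta> - ?m) < \<delta>'" for \<theta>
    proof -
      have "dist \<theta> \<theta>star \<le> dist \<theta> ?m + dist ?m \<theta>star" by (rule dist_triangle)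
      also have "\<dots> \<le> r / 2 + r / 2"
        using that cons \<delta>'(3) by (intro add_mono) (auto simp: dist_norm)
      finally show ?thesis by (simp add: dist_commute)
    qed
    have m_in: "?m \<in> cball \<theta>star r" using in_cball[of ?m] \<delta>'(1) by simp
    have set: "laplace_setting l u C \<delta>' c q0 q1 L D (?a * real n) ?m (\<lambda>h. h \<bullet> (H n x *v h))
       (\<lambda>\<theta>. (?L \<theta> / ?L ?m) powr ?a) (\<lambda>\<theta>. indicator \<Theta> \<theta> * \<pi> \<theta>)"
    proof (rule laplace_setting_posterior[OF model prior n x a _ _ pos _ _ _ \<delta>'(1) mean])
      show "1 \<le> ?a * real n" using aN N by linarith
      show "l * (norm h)\<^sup>2 \<le> h \<bullet> (H n x *v h) \<and> h \<bullet> (H n x *v h) \<le> u * (norm h)\<^sup>2" for h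
        using spec by blast
      show "0 < ?L (?m + t) \<and>
          \<bar>(ln (?L (?m + t)) - ln (?L ?m)) / real n + t \<bullet> (H n x *v t) / 2\<bar> \<le> C * norm t ^ 3"
        if "norm t < \<delta>'" for t
        using expand(2)[of t] rem[of t] that \<delta>'(2) by (simp add: g_def)
      show "?L \<theta> \<le> exp (- c * real n) * ?L ?m" if "\<delta>' \<le> norm (\<theta> - ?m)" for \<theta>
        using far n pos that likelihood_nonneg[OF model n x] by (rule likelihood_far)
      show "\<theta> \<in> \<Theta> \<and> q0 \<le> \<pi> \<theta> \<and> \<pi> \<theta> \<le> q1 \<and> \<bar>\<pi> \<theta> - \<pi> ?m\<bar> \<le> L * norm (\<theta> - ?m)"
        if "norm (\<theta> - ?m) < \<delta>'" for \<theta>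
        using in_cball[OF that] m_in qb qlip r\<Theta> by blast
      have "norm ?m \<le> norm \<theta>star + dist ?m \<theta>star"
        using norm_triangle_ineq[of \<theta>star "?m - \<theta>star"] by (simp add: dist_norm)
      then show "(\<integral>\<theta>. norm ((indicator \<Theta> \<theta> * \<pi> \<theta>) *\<^sub>R \<theta>) \<partial>lborel) + norm ?m \<le> D"
        using cons r unfolding D_def by linarith
    qed
    define w where "w \<theta> = (?L \<theta> / ?L ?m) powr ?a" for \<theta>
    define q where "q \<theta> = indicator \<Theta> \<theta> * \<pi> \<theta>" for \<theta>
    note set' = set[folded w_def q_def]
    define I where "I = (\<integral>\<theta>. w \<theta> * q \<theta> \<partial>lborel)"
    have I: "0 < I" and bound: "norm (\<integral>\<theta>. (w \<theta> * q \<theta>) *\<^sub>R (\<theta> - ?m) \<partial>lborel) \<le> K / (?a * real n) * I"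
      using laplace[OF set'] by (auto simp: I_def)
    have "posterior_mean f \<Theta> \<pi> n ?a x - ?m = (\<integral>\<theta>. (w \<theta> * q \<theta>) *\<^sub>R (\<theta> - ?m) \<partial>lborel) /\<^sub>R I"
      using posterior_mean_minus[of f \<Theta> n x ?m ?a \<pi>, folded w_def q_def, folded I_def,
          OF pos likelihood_nonneg[OF model n x] laplace_integrable[OF set' l C C\<delta> c] I] .
    then have "norm (posterior_mean f \<Theta> \<pi> n ?a x - ?m) \<le> K / (?a * real n)"
      using bound I by (simp add: field_simps)
    also have "\<dots> \<le> K / (\<alpha> n * real n / 2)"
      using K aN N by (intro divide_left_mono) auto
    also have "\<dots> = (2 * K) / (\<alpha> n * real n)" by (simp add: mult.commute)
    finally show "norm (posterior_mean f \<Theta> \<pi> n ?a x - ?m) \<le> (2 * K) / (\<alpha> n * real n)" .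
  qed
  then show ?thesis unfolding e_def by (intro exI[of _ "2 * K"]) simp
qed

lemma vanishing_slower_weaken:
  assumes "vanishing_slower (\<lambda>n. 1 / sqrt (real n)) \<alpha>"
  shows "vanishing_slower (\<lambda>n. 1 / real n) \<alpha>"
proof -
  have a: "\<forall>n\<ge>1. 0 < \<alpha> n" "(\<lambda>n. 1 / sqrt (real n) / \<alpha> n) \<longlonglongrightarrow> 0" "\<alpha> \<longlonglongrightarrow> 0"
    using assms by (auto simp: vanishing_slower_def)
  have "(\<lambda>n. 1 / real n / \<alpha> n) \<longlonglongrightarrow> 0"
  proof (rule Lim_null_comparison[OF _ a(2)], rule eventually_sequentiallyI)
    fix n :: nat assume n: "1 \<le> n"
    have "1 \<le> sqrt (real n)" using n by simp
    then have "sqrt (real n) * 1 \<le> sqrt (real n) * sqrt (real n)" by (intro mult_left_mono) auto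
    then have "sqrt (real n) \<le> real n" by simp
    then have "1 / real n \<le> 1 / sqrt (real n)" using n by (intro divide_left_mono) auto
    moreover have "0 < \<alpha> n" using a(1) n by blast
    ultimately have "1 / real n / \<alpha> n \<le> 1 / sqrt (real n) / \<alpha> n" by (intro divide_right_mono) auto
    moreover have "0 \<le> 1 / real n / \<alpha> n" using \<open>0 < \<alpha> n\<close> by simp
    ultimately show "norm (1 / real n / \<alpha> n) \<le> 1 / sqrt (real n) / \<alpha> n"
      by (simp only: real_norm_def abs_of_nonneg)
  qed
  then show ?thesis using a by (simp add: vanishing_slower_def)
qed

text \<open>The rate $1/\sqrt n \ll \alpha_n$ enters here: $\sqrt n$ times the distance of the posterior mean
  from the MLE is at most $K/(\alpha_n\sqrt n)$ with high probability.\<close>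

lemma posterior_mean_tends_in_distr:
  fixes \<nu> :: "(real ^ 'd) measure" and f :: "nat \<Rightarrow> 'd sample \<Rightarrow> real ^ 'p \<Rightarrow> real"
    and P :: "nat \<Rightarrow> 'd sample measure" and f0
  defines "P \<equiv> true_law \<nu> f0"
  assumes model: "statistical_model \<X> \<nu> f0 f \<Theta>" and prior: "is_prior \<Theta> \<pi>"
    and A0: "assm_A0 P f \<Theta> \<theta>hat \<theta>star V" and A1': "assm_A1' \<Theta> \<pi> \<theta>star"
    and A2': "assm_A2' P f \<Theta> \<theta>hat \<alpha>" and A3': "assm_A3' P f \<Theta> \<theta>hat"
    and \<alpha>: "vanishing_slower (\<lambda>n. 1 / sqrt (real n)) \<alpha>"
    and \<alpha>hat: "\<And>n. 1 \<le> n \<Longrightarrow> \<alpha>hat n \<in> borel_measurable (P n)"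
    and ratio: "tends_in_prob P (\<lambda>n x. \<alpha>hat n x / \<alpha> n) 1"
  shows "tends_in_distr P
     (\<lambda>n x. sqrt (real n) *\<^sub>R (posterior_mean f \<Theta> \<pi> n (\<alpha>hat n x) x - \<theta>star)) (centred_normal V)"
proof (rule tends_in_distr_perturb)
  have setsP: "sets (P n) = sets (sample_measure \<nu> n)" for n by (simp add: P_def true_law_def)
  show "prob_space (P n)" if "1 \<le> n" for n
  proof
    have "f0 n \<in> borel_measurable (sample_measure \<nu> n)" "(\<integral>\<^sup>+ x. ennreal (f0 n x) \<partial>sample_measure \<nu> n) = 1"
      using model that by (auto simp: statistical_model_def is_density_def)
    then show "emeasure (P n) (space (P n)) = 1"
      by (simp add: P_def true_law_def emeasure_density cong: nn_integral_cong)
  qed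
  show "tends_in_distr P (\<lambda>n x. sqrt (real n) *\<^sub>R (\<theta>hat n x - \<theta>star)) (centred_normal V)"
    using A0 by (simp add: assm_A0_def)
  show "sets (centred_normal V) = sets borel" by (simp add: centred_normal_def)
  show "(\<lambda>x. sqrt (real n) *\<^sub>R (posterior_mean f \<Theta> \<pi> n (\<alpha>hat n x) x - \<theta>star)) \<in> borel_measurable (P n)"
    if "1 \<le> n" for n
  proof -
    have "\<alpha>hat n \<in> borel_measurable (sample_measure \<nu> n)"
      using \<alpha>hat[OF that] measurable_cong_sets[OF setsP refl] by blast
    from measurable_posterior_mean[OF model prior that this]
    have [measurable]: "(\<lambda>x. posterior_mean f \<Theta> \<pi> n (\<alpha>hat n x) x) \<in> borel_measurable (P n)"
      using measurable_cong_sets[OF setsP refl] by blast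
    show ?thesis by measurable
  qed
  fix \<epsilon> \<eta> :: real assume \<epsilon>: "0 < \<epsilon>" and \<eta>: "0 < \<eta>"
  obtain K where K: "eventually_likely P \<epsilon> (\<lambda>n x.
      norm (posterior_mean f \<Theta> \<pi> n (\<alpha>hat n x) x - \<theta>hat n x) \<le> K / (\<alpha> n * real n))"
    using posterior_mean_near_MLE[OF model prior A0[unfolded P_def] A1' A2'[unfolded P_def] A3'[unfolded P_def]
        vanishing_slower_weaken[OF \<alpha>] ratio[unfolded P_def] \<epsilon>] unfolding P_def by blast
  have "(\<lambda>n. 1 / sqrt (real n) / \<alpha> n) \<longlonglongrightarrow> 0" using \<alpha> by (simp add: vanishing_slower_def)
  from tendsto_mult_left[OF this, of K] have "(\<lambda>n. K * (1 / sqrt (real n) / \<alpha> n)) \<longlonglongrightarrow> 0" by simp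
  then have small: "\<forall>\<^sub>F n in sequentially. K * (1 / sqrt (real n) / \<alpha> n) < \<eta>"
    using \<eta> by (rule order_tendstoD)
  note small_n = eventually_conj[OF small eventually_ge_at_top[of 1]]
  show "eventually_likely P \<epsilon> (\<lambda>n x. dist (sqrt (real n) *\<^sub>R (posterior_mean f \<Theta> \<pi> n (\<alpha>hat n x) x - \<theta>star))
      (sqrt (real n) *\<^sub>R (\<theta>hat n x - \<theta>star)) < \<eta>)"
  proof (rule eventually_likely_mono[OF K small_n])
    fix n x
    assume "K * (1 / sqrt (real n) / \<alpha> n) < \<eta> \<and> 1 \<le> n"
      and b: "norm (posterior_mean f \<Theta> \<pi> n (\<alpha>hat n x) x - \<theta>hat n x) \<le> K / (\<alpha> n * real n)"
    then have s: "K * (1 / sqrt (real n) / \<alpha> n) < \<eta>" and n: "1 \<le> n" by auto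
    have "dist (sqrt (real n) *\<^sub>R (posterior_mean f \<Theta> \<pi> n (\<alpha>hat n x) x - \<theta>star))
        (sqrt (real n) *\<^sub>R (\<theta>hat n x - \<theta>star))
        = sqrt (real n) * norm (posterior_mean f \<Theta> \<pi> n (\<alpha>hat n x) x - \<theta>hat n x)"
      by (simp add: dist_norm flip: scaleR_diff_right)
    also have "\<dots> \<le> sqrt (real n) * (K / (\<alpha> n * real n))" using b by (intro mult_left_mono) auto
    also have "\<dots> = sqrt (real n) * (K / (\<alpha> n * (sqrt (real n) * sqrt (real n))))" by simp
    also have "\<dots> = K * (1 / sqrt (real n) / \<alpha> n)"
      using n by (simp del: real_sqrt_mult_self)
    finally show "dist (sqrt (real n) *\<^sub>R (posterior_mean f \<Theta> \<pi> n (\<alpha>hat n x) x - \<theta>star))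
        (sqrt (real n) *\<^sub>R (\<theta>hat n x - \<theta>star)) < \<eta>" using s by simp
  qed
qed

theorem corollary2:
  fixes \<X> :: "(real ^ 'd) set"
    and \<nu> :: "(real ^ 'd) measure"
    and f0 :: "nat \<Rightarrow> 'd sample \<Rightarrow> real"
    and f :: "nat \<Rightarrow> 'd sample \<Rightarrow> real ^ 'p \<Rightarrow> real"
    and \<Theta> :: "(real ^ 'p) set"
    and \<pi> :: "real ^ 'p \<Rightarrow> real"
    and P :: "nat \<Rightarrow> 'd sample measure"
    and \<theta>hat :: "nat \<Rightarrow> 'd sample \<Rightarrow> real ^ 'p"
    and \<theta>star :: "real ^ 'p"
    and V :: "real ^ 'p ^ 'p"
  defines "P \<equiv> true_law \<nu> f0"
  assumes model: "statistical_model \<X> \<nu> f0 f \<Theta>"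
    and prior: "is_prior \<Theta> \<pi>"
    and proper: "\<And>n. n \<ge> 1 \<Longrightarrow> AE x in P n. \<forall>\<alpha>>0. posterior_proper f \<Theta> \<pi> n \<alpha> x"
    and A0: "assm_A0 P f \<Theta> \<theta>hat \<theta>star V"
    and A1': "assm_A1' \<Theta> \<pi> \<theta>star"
    and A2': "\<And>\<alpha>. vanishing_slower (\<lambda>n. 1 / real n) \<alpha> \<Longrightarrow> assm_A2' P f \<Theta> \<theta>hat \<alpha>"
    and A3': "assm_A3' P f \<Theta> \<theta>hat"
  shows "(\<forall>\<alpha>. vanishing_slower (\<lambda>n. 1 / sqrt (real n)) \<alpha> \<longrightarrow>
            tends_in_distr P
              (\<lambda>n x. sqrt (real n) *\<^sub>R (posterior_mean f \<Theta> \<pi> n (\<alpha> n) x - \<theta>star))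
              (centred_normal V))
       \<and> (\<forall>\<alpha>hat :: nat \<Rightarrow> 'd sample \<Rightarrow> real.
            (\<forall>n\<ge>1. \<alpha>hat n \<in> borel_measurable (P n)) \<longrightarrow>
            (\<forall>n\<ge>1. AE x in P n. 0 < \<alpha>hat n x) \<longrightarrow>
            (\<exists>\<alpha>. vanishing_slower (\<lambda>n. 1 / sqrt (real n)) \<alpha> \<and>
                 tends_in_prob P (\<lambda>n x. \<alpha>hat n x / \<alpha> n) 1) \<longrightarrow>
            tends_in_distr P
              (\<lambda>n x. sqrt (real n) *\<^sub>R (posterior_mean f \<Theta> \<pi> n (\<alpha>hat n x) x - \<theta>star))
              (centred_normal V))"
  proof (intro conjI allI impI)
  fix \<alpha> assume \<alpha>: "vanishing_slower (\<lambda>n. 1 / sqrt (real n)) \<alpha>"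
  have "tends_in_prob P (\<lambda>n x. \<alpha> n / \<alpha> n) 1"
    unfolding tends_in_prob_def
  proof (intro allI impI tendsto_eventually eventually_sequentiallyI)
    fix \<epsilon> :: real and n :: nat assume "0 < \<epsilon>" "1 \<le> n"
    then have "\<alpha> n \<noteq> 0" using \<alpha> by (force simp: vanishing_slower_def)
    then show "outer_prob (P n) (\<lambda>x. \<epsilon> < dist (\<alpha> n / \<alpha> n) 1) = 0"
      using \<open>0 < \<epsilon>\<close> by (simp add: outer_prob_def)
  qed
  then show "tends_in_distr P
      (\<lambda>n x. sqrt (real n) *\<^sub>R (posterior_mean f \<Theta> \<pi> n (\<alpha> n) x - \<theta>star)) (centred_normal V)"
    using posterior_mean_tends_in_distr[OF model prior A0[unfolded P_def] A1'
        A2'[OF vanishing_slower_weaken[OF \<alpha>], unfolded P_def] A3'[unfolded P_def] \<alpha>, of "\<lambda>n x. \<alpha> n"]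
    by (simp add: P_def)
next
  fix \<alpha>hat :: "nat \<Rightarrow> 'd sample \<Rightarrow> real"
  assume meas: "\<forall>n\<ge>1. \<alpha>hat n \<in> borel_measurable (P n)"
    and "\<exists>\<alpha>. vanishing_slower (\<lambda>n. 1 / sqrt (real n)) \<alpha> \<and> tends_in_prob P (\<lambda>n x. \<alpha>hat n x / \<alpha> n) 1"
  then obtain \<alpha> where \<alpha>: "vanishing_slower (\<lambda>n. 1 / sqrt (real n)) \<alpha>"
    and ratio: "tends_in_prob P (\<lambda>n x. \<alpha>hat n x / \<alpha> n) 1"
    by blast
  show "tends_in_distr P
      (\<lambda>n x. sqrt (real n) *\<^sub>R (posterior_mean f \<Theta> \<pi> n (\<alpha>hat n x) x - \<theta>star)) (centred_normal V)"
    using posterior_mean_tends_in_distr[OF model prior A0[unfolded P_def] A1'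
        A2'[OF vanishing_slower_weaken[OF \<alpha>], unfolded P_def] A3'[unfolded P_def] \<alpha> _ ratio[unfolded P_def]]
      meas by (simp add: P_def)
qed

end
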